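(* Let $K$ be an infinite field and $X$ a finite set, $n=|X|$. Then the set of all free bases of $\mathbb{A}_K(X)$ is $0$-definable in $\mathbb{A}_K(X)$; that is, there is a first-order formula $Gen(v_1,\dots,v_n)$ of the language of rings, without parameters, such that for all $a_1,\dots,a_n\in\mathbb{A}_K(X)$, $\mathbb{A}_K(X)\models Gen(a_1,\dots,a_n)$ if and only if $\{a_1,\dots,a_n\}$ is a free basis of $\mathbb{A}_K(X)$ (of cardinality $n$).
   Context: $\mathbb{A}_K(X)$ denotes the free associative unitary algebra over $K$ with free basis $X$, viewed as a structure in the language of rings $\{+,\cdot,0,1\}$. A free basis is a subset $V$ such that $\mathbb{A}_K(X)$ is the free associative unitary $K$-algebra on $V$ (equivalently, the monomials in $V$, including the empty monomial $1$, form a $K$-basis of $\mathbb{A}_K(X)$). *)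

theory Defs
  imports Complex_Main "HOL-Library.Poly_Mapping"
begin

text \<open>Variables are natural numbers; there are no constant symbols besides \<open>0\<close> and \<open>1\<close>,
  so every formula is parameter-free.\<close>

datatype ring_term =
    TVar nat
  | TZero
  | TOne
  | TAdd ring_term ring_term
  | TMul ring_term ring_term

datatype ring_formula =
    FEq ring_term ring_term
  | FNot ring_formula
  | FAnd ring_formula ring_formula
  | FEx nat ring_formula

primrec term_vars :: "ring_term \<Rightarrow> nat set" where
  "term_vars (TVar i) = {i}"
| "term_vars TZero = {}"
| "term_vars TOne = {}"
| "term_vars (TAdd s t) = term_vars s \<union> term_vars t"
| "term_vars (TMul s t) = term_vars s \<union> term_vars t"

primrec free_vars :: "ring_formula \<Rightarrow> nat set" where
  "free_vars (FEq s t) = term_vars s \<union> term_vars t"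
| "free_vars (FNot f) = free_vars f"
| "free_vars (FAnd f g) = free_vars f \<union> free_vars g"
| "free_vars (FEx i f) = free_vars f - {i}"

primrec term_val :: "(nat \<Rightarrow> 'a::ring_1) \<Rightarrow> ring_term \<Rightarrow> 'a" where
  "term_val e (TVar i) = e i"
| "term_val e TZero = 0"
| "term_val e TOne = 1"
| "term_val e (TAdd s t) = term_val e s + term_val e t"
| "term_val e (TMul s t) = term_val e s * term_val e t"

text \<open>The structure is the subring \<open>A\<close> of the ambient ring type: quantifiers range over \<open>A\<close>.\<close>

primrec satisfies :: "'a::ring_1 set \<Rightarrow> (nat \<Rightarrow> 'a) \<Rightarrow> ring_formula \<Rightarrow> bool" where
  "satisfies A e (FEq s t) \<longleftrightarrow> term_val e s = term_val e t"
| "satisfies A e (FNot f) \<longleftrightarrow> \<not> satisfies A e f"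
| "satisfies A e (FAnd f g) \<longleftrightarrow> satisfies A e f \<and> satisfies A e g"
| "satisfies A e (FEx i f) \<longleftrightarrow> (\<exists>a\<in>A. satisfies A (e(i := a)) f)"

text \<open>Words under concatenation, written additively so that the convolution product of
  \<^theory>\<open>HOL-Library.Poly_Mapping\<close> on finitely supported functions becomes the product
  of the monoid algebra of words.\<close>

datatype 'x free_monoid = Word (letters: "'x list")

instantiation free_monoid :: (type) monoid_add
begin

definition zero_free_monoid :: "'a free_monoid" where
  "0 = Word []"

definition plus_free_monoid :: "'a free_monoid \<Rightarrow> 'a free_monoid \<Rightarrow> 'a free_monoid" where
  "u + v = Word (letters u @ letters v)"

instance
  by standard (simp_all add: zero_free_monoid_def plus_free_monoid_def)

end

definition free_algebra :: "'x set \<Rightarrow> ('x free_monoid \<Rightarrow>\<^sub>0 'k::field) set" where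
  "free_algebra X = {p. \<forall>w\<in>Poly_Mapping.keys p. set (letters w) \<subseteq> X}"

definition gen :: "'x \<Rightarrow> ('x free_monoid \<Rightarrow>\<^sub>0 'k::field)" where
  "gen x = Poly_Mapping.single (Word [x]) 1"

definition scalar_mult ::
    "'k::field \<Rightarrow> ('x free_monoid \<Rightarrow>\<^sub>0 'k) \<Rightarrow> ('x free_monoid \<Rightarrow>\<^sub>0 'k)" where
  "scalar_mult c p = Poly_Mapping.map ((*) c) p"

interpretation free_alg: vector_space
  "scalar_mult :: 'k::field \<Rightarrow> ('x free_monoid \<Rightarrow>\<^sub>0 'k) \<Rightarrow> ('x free_monoid \<Rightarrow>\<^sub>0 'k)"
  by standard
    (simp_all add: scalar_mult_def mult_map_scale_conv_mult single_add distrib_left distrib_right mult_single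
      flip: mult.assoc)

text \<open>\<open>V\<close> is a free basis iff the monomials in \<open>V\<close>, as a family indexed by the words over \<open>V\<close>,
  form a \<open>K\<close>-basis. Injectivity of \<open>prod_list\<close> is needed because linear independence of the mere
  set of products would not exclude that distinct words have the same value (for instance if
  \<open>V = {1}\<close>).\<close>

definition is_free_basis ::
    "'x set \<Rightarrow> ('x free_monoid \<Rightarrow>\<^sub>0 'k::field) set \<Rightarrow> bool" where
  "is_free_basis X V \<longleftrightarrow>
     V \<subseteq> free_algebra X \<and>
     inj_on prod_list (lists V) \<and>
     free_alg.independent (prod_list ` lists V) \<and>
     free_alg.span (prod_list ` lists V) = free_algebra X"

lemma scalar_mult_single:
  "scalar_mult c (Poly_Mapping.single w d) = Poly_Mapping.single w (c * d)"
  by (simp add: scalar_mult_def mult_map_scale_conv_mult mult_single)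

lemma prod_list_gen:
  "prod_list (map gen xs) = (Poly_Mapping.single (Word xs) 1 :: 'x free_monoid \<Rightarrow>\<^sub>0 'k::field)"
proof (induction xs)
  case Nil
  show ?case by (simp flip: zero_free_monoid_def)
next
  case (Cons x xs)
  then show ?case by (simp add: gen_def mult_single plus_free_monoid_def)
qed

lemma lookup_scalar_mult:
  "Poly_Mapping.lookup (scalar_mult c p) w = c * Poly_Mapping.lookup p w"
by (simp add: scalar_mult_def Poly_Mapping.map.rep_eq when_def)

text \<open>Consistency of the two descriptions: the canonical generators form a free basis.\<close>

lemma is_free_basis_gen:
  "is_free_basis X (gen ` X :: ('x free_monoid \<Rightarrow>\<^sub>0 'k::field) set)"
proof -
  let ?m = "\<lambda>xs. Poly_Mapping.single (Word xs) 1 :: 'x free_monoid \<Rightarrow>\<^sub>0 'k"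
  have inj_m: "inj ?m"
    by (auto intro!: injI dest!: arg_cong[where f = Poly_Mapping.keys])
  have L: "lists (gen ` X) = map gen ` lists X"
    by (rule lists_image)
  have img: "prod_list ` lists (gen ` X) = ?m ` lists X"
    unfolding L image_image prod_list_gen ..
  have inj: "inj_on prod_list (lists (gen ` X) :: ('x free_monoid \<Rightarrow>\<^sub>0 'k) list set)"
    unfolding L by (rule inj_onI) (use inj_m in \<open>auto simp: prod_list_gen dest: injD\<close>)
  have subsp: "free_alg.subspace (free_algebra X :: ('x free_monoid \<Rightarrow>\<^sub>0 'k) set)"
  proof (rule free_alg.subspaceI)
    fix p q :: "'x free_monoid \<Rightarrow>\<^sub>0 'k"
    assume "p \<in> free_algebra X" "q \<in> free_algebra X"
    then show "p + q \<in> free_algebra X"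
      using Poly_Mapping.keys_add[of p q] unfolding free_algebra_def by blast
  next
    fix c and p :: "'x free_monoid \<Rightarrow>\<^sub>0 'k"
    assume "p \<in> free_algebra X"
    moreover have "Poly_Mapping.keys (scalar_mult c p) \<subseteq> Poly_Mapping.keys p"
      by (auto simp: in_keys_iff lookup_scalar_mult)
    ultimately show "scalar_mult c p \<in> free_algebra X"
      unfolding free_algebra_def by blast
  qed (simp add: free_algebra_def)
  have mem: "?m ` lists X \<subseteq> free_algebra X"
    by (auto simp: free_algebra_def)
  have "p \<in> free_alg.span (?m ` lists X)" if "p \<in> free_algebra X" for p
    using that
  proof (induction p rule: update_induct)
    case const
    then show ?case by (simp add: free_alg.span_zero)
  next
    case (update p a b)
    have eq: "Poly_Mapping.update a b p = p + Poly_Mapping.single a b"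
      using update by (intro poly_mapping_eqI) (auto simp: lookup_update lookup_add lookup_single when_def in_keys_iff)
    have k: "Poly_Mapping.keys (Poly_Mapping.update a b p) = insert a (Poly_Mapping.keys p)"
      using update by (auto simp: in_keys_iff lookup_update split: if_splits)
    have a: "letters a \<in> lists X" and p: "p \<in> free_algebra X"
      using update.prems k by (force simp: free_algebra_def)+
    have "Poly_Mapping.single a b = scalar_mult b (?m (letters a))"
      by (simp add: scalar_mult_single)
    also have "\<dots> \<in> free_alg.span (?m ` lists X)"
      using a by (intro free_alg.span_scale free_alg.span_base imageI)
    finally show ?case
      unfolding eq using update.IH[OF p] by (intro free_alg.span_add)
  qed
  then have span: "free_alg.span (?m ` lists X) = free_algebra X"
    using free_alg.span_minimal[OF mem subsp] by blast
  have "free_alg.independent (?m ` lists X)"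
    unfolding free_alg.independent_explicit_module
  proof (intro allI impI)
    fix t u v
    assume t: "finite t" "t \<subseteq> ?m ` lists X" "(\<Sum>v\<in>t. scalar_mult (u v) v) = 0" "v \<in> t"
    then obtain xs where v: "v = ?m xs" by blast
    have "0 = Poly_Mapping.lookup (\<Sum>v\<in>t. scalar_mult (u v) v) (Word xs)"
      using t by simp
    also have "\<dots> = (\<Sum>w\<in>t. if w = v then u v else 0)"
      unfolding Poly_Mapping.lookup_sum
    proof (intro sum.cong refl)
      fix w assume "w \<in> t"
      with t(2) obtain ys where "w = ?m ys" by blast
      then show "Poly_Mapping.lookup (scalar_mult (u w) w) (Word xs) = (if w = v then u v else 0)"
        by (auto simp: v lookup_scalar_mult lookup_single when_def dest: injD[OF inj_m])
    qed
    also have "\<dots> = u v" using t by simp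
    finally show "u v = 0" ..
  qed
  then show ?thesis
    unfolding is_free_basis_def img using inj span by (auto simp: free_algebra_def gen_def)
qed

end

theory Submission
  imports Defs
begin

text \<open>
  The field \<open>K\<close> is definable as the set of units together with \<open>0\<close>. The monomials in \<open>a\<close> are
  linearly independent and span if and only if \<open>c + (\<Sum>i<n. a i * f i) = 0\<close> forces \<open>f = 0\<close>
  (a first-order condition) and every \<open>f\<close> is reached from \<open>K\<close> by finitely many steps
  \<open>(g i)\<^sub>i \<mapsto> c + (\<Sum>i<n. a i * g i)\<close>. For \<open>n \<le> 1\<close> the second condition only says that every
  \<open>f\<close> has such a decomposition, since degrees decrease. For \<open>2 \<le> n\<close> it says that \<open>f\<close> belongs to a
  finite set of elements closed under decomposition, each element being paired with a power of \<open>a 0\<close>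
  that loses a factor in every step and so forces termination. Finite sets of pairs are coded by
  triples of elements through interpolation in the variable \<open>a 0\<close>, with the coded elements
  as coefficients on the right of \<open>a 1\<close>; this needs that \<open>K\<close> is infinite.
\<close>

section \<open>Infinite fields inside domains with a degree function\<close>

definition words :: "nat \<Rightarrow> nat \<Rightarrow> nat list set" where
  "words n N = {w. set w \<subseteq> {..<n} \<and> length w \<le> N}"

lemma finite_words [simp]: "finite (words n N)"
  unfolding words_def by (rule finite_lists_length_le) simp

lemma words_0: "words n 0 = {[]}"
  by (auto simp: words_def)

lemma words_mono: "N \<le> M \<Longrightarrow> words n N \<subseteq> words n M"
  by (auto simp: words_def)

lemma words_Suc: "words n (Suc N) = insert [] (\<Union>i<n. (#) i ` words n N)"
proof (intro equalityI subsetI)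
  fix w assume "w \<in> words n (Suc N)"
  then show "w \<in> insert [] (\<Union>i<n. (#) i ` words n N)"
    by (cases w) (auto simp: words_def)
qed (auto simp: words_def)

lemma sum_words_Suc:
  fixes F :: "nat list \<Rightarrow> 'r::comm_monoid_add"
  shows "(\<Sum>w\<in>words n (Suc N). F w) = F [] + (\<Sum>i<n. \<Sum>w\<in>words n N. F (i # w))"
proof -
  have "(\<Sum>w\<in>words n (Suc N). F w) = F [] + (\<Sum>w\<in>(\<Union>i<n. (#) i ` words n N). F w)"
    unfolding words_Suc by (rule sum.insert) auto
  also have "(\<Sum>w\<in>(\<Union>i<n. (#) i ` words n N). F w) = (\<Sum>i<n. \<Sum>w\<in>(#) i ` words n N. F w)"
    by (rule sum.UNION_disjoint) auto
  also have "\<dots> = (\<Sum>i<n. \<Sum>w\<in>words n N. F (i # w))"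
    by (simp add: sum.reindex)
  finally show ?thesis .
qed

definition word_comb :: "(nat \<Rightarrow> 'r::ring_1) \<Rightarrow> nat \<Rightarrow> nat \<Rightarrow> (nat list \<Rightarrow> 'r) \<Rightarrow> 'r" where
  "word_comb a n N u = (\<Sum>w\<in>words n N. u w * prod_list (map a w))"

text \<open>What the argument uses of the free algebra: \<open>A\<close> is the structure,
  \<open>K\<close> its scalars. Centrality, absence of zero divisors and the degree laws hold in the
  whole ambient ring, which in the application is the algebra over all of \<open>'x\<close>. As 0
  has degree 0 by \<open>deg_eq_0\<close>, additivity of degrees is stated for nonzero
  factors.\<close>

locale degree_domain =
  fixes A K :: "'r::ring_1 set" and deg :: "'r \<Rightarrow> nat"
  assumes A_add: "x \<in> A \<Longrightarrow> y \<in> A \<Longrightarrow> x + y \<in> A"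
    and A_mult: "x \<in> A \<Longrightarrow> y \<in> A \<Longrightarrow> x * y \<in> A"
    and A_uminus: "x \<in> A \<Longrightarrow> - x \<in> A"
    and K_subset: "K \<subseteq> A"
    and zero_K: "0 \<in> K"
    and one_K: "1 \<in> K"
    and K_add: "c \<in> K \<Longrightarrow> d \<in> K \<Longrightarrow> c + d \<in> K"
    and K_mult: "c \<in> K \<Longrightarrow> d \<in> K \<Longrightarrow> c * d \<in> K"
    and K_uminus: "c \<in> K \<Longrightarrow> - c \<in> K"
    and K_central: "c \<in> K \<Longrightarrow> c * x = x * c"
    and K_inverse: "c \<in> K \<Longrightarrow> c \<noteq> 0 \<Longrightarrow> \<exists>d\<in>K. c * d = 1"
    and infinite_K: "infinite K"
    and no_zero_div: "(x::'r) \<noteq> 0 \<Longrightarrow> y \<noteq> 0 \<Longrightarrow> x * y \<noteq> 0"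
    and deg_mult: "x \<noteq> 0 \<Longrightarrow> y \<noteq> 0 \<Longrightarrow> deg (x * y) = deg x + deg y"
    and deg_add: "deg (x + y) \<le> max (deg x) (deg y)"
    and deg_eq_0: "deg x = 0 \<longleftrightarrow> x \<in> K"
begin

lemma KA: "c \<in> K \<Longrightarrow> c \<in> A"
  using K_subset by blast

lemma A_diff: "x \<in> A \<Longrightarrow> y \<in> A \<Longrightarrow> x - y \<in> A"
  using A_add[of x "- y"] A_uminus[of y] by simp

lemma K_diff: "x \<in> K \<Longrightarrow> y \<in> K \<Longrightarrow> x - y \<in> K"
  using K_add[of x "- y"] K_uminus[of y] by simp

lemma A_power: "x \<in> A \<Longrightarrow> x ^ m \<in> A"
  by (induction m) (auto simp: A_mult KA one_K)

lemma power_nonzero: "(x::'r) \<noteq> 0 \<Longrightarrow> x ^ m \<noteq> 0"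
  by (induction m) (auto simp: no_zero_div)

lemma A_sum: "(\<And>i. i \<in> I \<Longrightarrow> f i \<in> A) \<Longrightarrow> sum f I \<in> A"
  by (induction I rule: infinite_finite_induct) (auto simp: A_add KA zero_K)

text \<open>Degrees of nonzero factors add up, so a factor of 1 has degree 0. This makes
  \<open>K\<close> definable without parameters, and formulas may quantify over scalars.\<close>

lemma in_K_iff_unit:
  assumes "x \<in> A"
  shows "x \<in> K \<longleftrightarrow> x = 0 \<or> (\<exists>y\<in>A. x * y = 1)"
proof
  assume "x \<in> K"
  then show "x = 0 \<or> (\<exists>y\<in>A. x * y = 1)"
    using K_inverse KA by blast
next
  assume "x = 0 \<or> (\<exists>y\<in>A. x * y = 1)"
  then show "x \<in> K"
  proof
    assume "\<exists>y\<in>A. x * y = 1"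
    then obtain y where y: "x * y = 1" by blast
    show ?thesis
    proof (cases "x = 0 \<or> y = 0")
      case False
      then have "deg x + deg y = deg 1"
        using deg_mult y by metis
      then show ?thesis
        using deg_eq_0[of x] deg_eq_0[of 1] one_K by simp
    next
      case True
      then have "(1::'r) = 0" using y by auto
      then show ?thesis using zero_K by (metis mult_1 mult_zero_left)
    qed
  qed (use zero_K in simp)
qed

section \<open>Independence and generation in terms of words\<close>

definition right_independent :: "(nat \<Rightarrow> 'r) \<Rightarrow> nat \<Rightarrow> bool" where
  "right_independent a n \<longleftrightarrow>
     (\<forall>c\<in>K. \<forall>f. (\<forall>i<n. f i \<in> A) \<longrightarrow> c + (\<Sum>i<n. a i * f i) = 0 \<longrightarrow> (\<forall>i<n. f i = 0))"

lemma right_independentD: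
  assumes "right_independent a n" "c \<in> K" "\<forall>i<n. f i \<in> A" "c + (\<Sum>i<n. a i * f i) = 0" "i < n"
  shows "f i = 0"
  using assms unfolding right_independent_def by blast

definition spanned :: "(nat \<Rightarrow> 'r) \<Rightarrow> nat \<Rightarrow> nat \<Rightarrow> 'r set" where
  "spanned a n N = {word_comb a n N u | u. range u \<subseteq> K}"

definition generating :: "(nat \<Rightarrow> 'r) \<Rightarrow> nat \<Rightarrow> bool" where
  "generating a n \<longleftrightarrow> (\<forall>x\<in>A. \<exists>N. x \<in> spanned a n N)"

text \<open>Nonempty words are grouped by their first letter \<open>i\<close>; central coefficients
  let \<open>a i\<close> move to the front.\<close>

lemma word_comb_Suc:
  assumes "range u \<subseteq> K"
  shows "word_comb a n (Suc N) u = u [] + (\<Sum>i<n. a i * word_comb a n N (\<lambda>w. u (i # w)))"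
proof -
  have "u (i # w) * (a i * x) = a i * (u (i # w) * x)" for i w x
    using K_central[of "u (i # w)" "a i"] assms by (metis mult.assoc rangeI subsetD)
  then show ?thesis
    unfolding word_comb_def sum_words_Suc by (simp add: sum_distrib_left)
qed

lemma spanned_0: "spanned a n 0 = K"
proof -
  have "word_comb a n 0 u = u []" for u :: "nat list \<Rightarrow> 'r"
    by (simp add: word_comb_def words_0)
  moreover have "c \<in> K \<Longrightarrow> \<exists>u. c = u [] \<and> range u \<subseteq> K" for c
    by (intro exI[of _ "\<lambda>_. c"]) auto
  ultimately show ?thesis by (auto simp: spanned_def)
qed

text \<open>Reverses \<open>word_comb_Suc\<close> by gluing coefficient functions of the
  \<open>g i\<close> along the first letter. The function \<open>u\<close> is exposed because the
  independence argument inspects its values.\<close>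

lemma exists_coefficients:
  assumes c: "c \<in> K" and g: "\<forall>i<n. g i \<in> spanned a n N"
  obtains u where "range u \<subseteq> K" "u [] = c" "\<And>i. i < n \<Longrightarrow> word_comb a n N (\<lambda>w. u (i # w)) = g i"
    "word_comb a n (Suc N) u = c + (\<Sum>i<n. a i * g i)"
proof -
  have "\<forall>i. \<exists>v. i < n \<longrightarrow> range v \<subseteq> K \<and> g i = word_comb a n N v"
    using g unfolding spanned_def by blast
  then obtain v where v: "\<And>i. i < n \<Longrightarrow> range (v i) \<subseteq> K \<and> g i = word_comb a n N (v i)"
    by metis
  \<comment> \<open>Words starting with a letter outside \<open>{..<n}\<close> never enter the sums;
    the value 0 only keeps the range of \<open>u\<close> inside \<open>K\<close>.\<close>
  define u where "u = (\<lambda>w. case w of [] \<Rightarrow> c | i # w' \<Rightarrow> if i < n then v i w' else 0)"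
  have "u w \<in> K" for w
    using c v zero_K by (cases w) (auto simp: u_def image_subset_iff)
  then have u: "range u \<subseteq> K" by blast
  have "u [] = c" "\<And>i. i < n \<Longrightarrow> word_comb a n N (\<lambda>w. u (i # w)) = g i"
    using v by (simp_all add: u_def)
  then show thesis
    using that[OF u] word_comb_Suc[OF u] by simp
qed

lemma spanned_Suc:
  "x \<in> spanned a n (Suc N) \<longleftrightarrow>
     (\<exists>c\<in>K. \<exists>g. (\<forall>i<n. g i \<in> spanned a n N) \<and> x = c + (\<Sum>i<n. a i * g i))"
proof
  assume "x \<in> spanned a n (Suc N)"
  then obtain u where u: "range u \<subseteq> K" "x = word_comb a n (Suc N) u"
    by (auto simp: spanned_def)
  have "word_comb a n N (\<lambda>w. u (i # w)) \<in> spanned a n N" for i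
    using u(1) by (auto simp: spanned_def)
  moreover have "u [] \<in> K" using u(1) by auto
  ultimately show "\<exists>c\<in>K. \<exists>g. (\<forall>i<n. g i \<in> spanned a n N) \<and> x = c + (\<Sum>i<n. a i * g i)"
    unfolding u(2) word_comb_Suc[OF u(1)]
    by (intro bexI[of _ "u []"] exI[of _ "\<lambda>i. word_comb a n N (\<lambda>w. u (i # w))"]) auto
next
  assume "\<exists>c\<in>K. \<exists>g. (\<forall>i<n. g i \<in> spanned a n N) \<and> x = c + (\<Sum>i<n. a i * g i)"
  then obtain c g where c: "c \<in> K" and g: "\<forall>i<n. g i \<in> spanned a n N"
    and x: "x = c + (\<Sum>i<n. a i * g i)" by blast
  obtain u where "range u \<subseteq> K" "word_comb a n (Suc N) u = x"
    using exists_coefficients[OF c g] x by metis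
  then show "x \<in> spanned a n (Suc N)" unfolding spanned_def by blast
qed

lemma spanned_mono: "N \<le> M \<Longrightarrow> spanned a n N \<subseteq> spanned a n M"
proof
  fix x assume "N \<le> M" "x \<in> spanned a n N"
  then obtain u where u: "range u \<subseteq> K" "x = word_comb a n N u"
    by (auto simp: spanned_def)
  let ?u = "\<lambda>w. if w \<in> words n N then u w else 0"
  have "x = word_comb a n M ?u"
    unfolding u(2) word_comb_def using words_mono[OF \<open>N \<le> M\<close>]
    by (intro sum.mono_neutral_cong_left) auto
  moreover have "range ?u \<subseteq> K" using u(1) zero_K by auto
  ultimately show "x \<in> spanned a n M" unfolding spanned_def by blast
qed

lemma spanned_scale:
  assumes "c \<in> K" "x \<in> spanned a n N"
  shows "c * x \<in> spanned a n N"
proof -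
  obtain u where "range u \<subseteq> K" "x = word_comb a n N u" using assms(2) by (auto simp: spanned_def)
  then have "range (\<lambda>w. c * u w) \<subseteq> K" "c * x = word_comb a n N (\<lambda>w. c * u w)"
    using K_mult[OF assms(1)] by (auto simp: word_comb_def sum_distrib_left mult.assoc)
  then show ?thesis unfolding spanned_def by blast
qed

lemma spanned_add:
  assumes "x \<in> spanned a n N" "y \<in> spanned a n M"
  shows "x + y \<in> spanned a n (max N M)"
proof -
  have "x \<in> spanned a n (max N M)" "y \<in> spanned a n (max N M)"
    using assms spanned_mono[of N "max N M", THEN subsetD] spanned_mono[of M "max N M", THEN subsetD]
    by auto
  then obtain u v where u: "range u \<subseteq> K" "x = word_comb a n (max N M) u"
    and v: "range v \<subseteq> K" "y = word_comb a n (max N M) v"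
    by (auto simp: spanned_def)
  then have "x + y = word_comb a n (max N M) (\<lambda>w. u w + v w)"
    by (simp add: word_comb_def distrib_right sum.distrib)
  moreover have "u w + v w \<in> K" for w using u(1) v(1) K_add by blast
  then have "range (\<lambda>w. u w + v w) \<subseteq> K" by blast
  ultimately show ?thesis unfolding spanned_def by blast
qed

text \<open>Indexing by words instead of by their values turns a coincidence of two products into a
  nontrivial relation.\<close>

definition word_independent :: "(nat \<Rightarrow> 'r) \<Rightarrow> nat \<Rightarrow> bool" where
  "word_independent a n \<longleftrightarrow>
     (\<forall>N u. range u \<subseteq> K \<longrightarrow> word_comb a n N u = 0 \<longrightarrow> (\<forall>w\<in>words n N. u w = 0))"

lemma spanned_common:
  assumes "\<forall>i<n. \<exists>N. g i \<in> spanned a n N"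
  shows "\<exists>N. \<forall>i<n. g i \<in> spanned a n N"
proof -
  obtain M where M: "\<forall>i<n. g i \<in> spanned a n (M i)" using assms by metis
  have "g i \<in> spanned a n (\<Sum>i<n. M i)" if "i < n" for i
    using M that spanned_mono[of "M i" "\<Sum>i<n. M i"] member_le_sum[of i "{..<n}" M] by auto
  then show ?thesis by blast
qed

lemma spanned_subset:
  assumes "\<forall>i<n. a i \<in> A"
  shows "spanned a n N \<subseteq> A"
proof (induction N)
  case 0
  then show ?case using K_subset by (simp add: spanned_0)
next
  case (Suc N)
  show ?case
  proof
    fix x assume "x \<in> spanned a n (Suc N)"
    then show "x \<in> A"
      unfolding spanned_Suc using Suc assms by (auto simp: KA intro!: A_add A_sum A_mult)
  qed
qed

text \<open>Splitting off first letters turns a vanishing combination into a relation whose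
  cofactors are shorter combinations. Right independence makes these vanish, and induction on word
  length continues.\<close>

lemma right_independent_imp_word_independent:
  assumes a: "\<forall>i<n. a i \<in> A" and ind: "right_independent a n"
  shows "word_independent a n"
  unfolding word_independent_def
proof (intro allI impI)
  fix N and u :: "nat list \<Rightarrow> 'r"
  assume "range u \<subseteq> K" "word_comb a n N u = 0"
  then show "\<forall>w\<in>words n N. u w = 0"
  proof (induction N arbitrary: u)
    case 0
    then show ?case by (simp add: word_comb_def words_0)
  next
    case (Suc N)
    let ?f = "\<lambda>i. word_comb a n N (\<lambda>w. u (i # w))"
    have sub: "range (\<lambda>w. u (i # w)) \<subseteq> K" for i using Suc.prems(1) by blast
    have "?f i \<in> spanned a n N" for i using sub[of i] unfolding spanned_def by blast
    then have fA: "\<forall>i<n. ?f i \<in> A" using spanned_subset[OF a, of N] by blast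
    have u0: "u [] \<in> K" using Suc.prems(1) by blast
    have zero: "u [] + (\<Sum>i<n. a i * ?f i) = 0"
      using Suc.prems(2) unfolding word_comb_Suc[OF Suc.prems(1)] .
    have f0: "?f i = 0" if "i < n" for i
      using right_independentD[OF ind u0 fA zero that] .
    then have "u [] = 0" using zero by simp
    moreover have "\<forall>w\<in>words n N. u (i # w) = 0" if "i < n" for i
      using Suc.IH[OF sub f0[OF that]] .
    ultimately show ?case by (auto simp: words_Suc)
  qed
qed

text \<open>The cofactors are arbitrary elements of \<open>A\<close>; generation expands them into
  words, so that the relation becomes a single vanishing combination of words.\<close>

lemma word_independent_imp_right_independent:
  assumes gen: "generating a n" and ind: "word_independent a n"
  shows "right_independent a n"
  unfolding right_independent_def
proof (intro ballI allI impI)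
  fix c f i
  assume c: "c \<in> K" and f: "\<forall>i<n. f i \<in> A" and eq: "c + (\<Sum>i<n. a i * f i) = 0" and i: "i < n"
  have "\<forall>i<n. \<exists>N. f i \<in> spanned a n N" using gen f by (simp add: generating_def)
  then obtain N where "\<forall>i<n. f i \<in> spanned a n N" using spanned_common by blast
  from exists_coefficients[OF c this] obtain u where u: "range u \<subseteq> K"
    and f_eq: "\<And>i. i < n \<Longrightarrow> word_comb a n N (\<lambda>w. u (i # w)) = f i"
    and "word_comb a n (Suc N) u = c + (\<Sum>i<n. a i * f i)" by metis
  then have "word_comb a n (Suc N) u = 0" using eq by simp
  then have "\<forall>w\<in>words n (Suc N). u w = 0" using ind u unfolding word_independent_def by blast
  then have "u (i # w) = 0" if "w \<in> words n N" for w
    using that i by (simp add: words_def)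
  then have "word_comb a n N (\<lambda>w. u (i # w)) = 0" by (simp add: word_comb_def)
  then show "f i = 0" using f_eq[OF i] by simp
qed

lemma generating_decompose:
  assumes "generating a n" "\<forall>i<n. a i \<in> A" "x \<in> A"
  shows "\<exists>c\<in>K. \<exists>g. (\<forall>i<n. g i \<in> A) \<and> x = c + (\<Sum>i<n. a i * g i)"
proof -
  obtain N where "x \<in> spanned a n N" using assms by (auto simp: generating_def)
  then have "x \<in> spanned a n (Suc N)" using spanned_mono[of N "Suc N"] by auto
  then show ?thesis
    unfolding spanned_Suc using spanned_subset[OF assms(2), of N] by blast
qed

text \<open>A nonconstant \<open>a 0\<close> makes each decomposition lower the degree, so the
  recursion ends. With several generators leading terms may cancel between summands, hence the
  restriction to \<open>n \<le> 1\<close>.\<close>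

lemma generating_singleton:
  assumes ind: "right_independent a n" and a: "\<forall>i<n. a i \<in> A" and n: "n \<le> 1"
    and dec: "\<forall>x\<in>A. \<exists>c\<in>K. \<exists>g. (\<forall>i<n. g i \<in> A) \<and> x = c + (\<Sum>i<n. a i * g i)"
  shows "generating a n"
  unfolding generating_def
proof
  fix x assume "x \<in> A"
  then show "\<exists>N. x \<in> spanned a n N"
  proof (induction "deg x" arbitrary: x rule: less_induct)
    case less
    obtain c g where c: "c \<in> K" and g: "\<forall>i<n. g i \<in> A" and x: "x = c + (\<Sum>i<n. a i * g i)"
      using dec less.prems by blast
    show ?case
    proof (cases "x \<in> K")
      case True
      then show ?thesis using spanned_0 by blast
    next
      case False
      have "n = 1" using n False c x by (cases n) auto
      then have x: "x = c + a 0 * g 0" using x by simp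
      have nz: "a 0 \<noteq> 0" "g 0 \<noteq> 0" using x False c by auto
      have "a 0 \<notin> K"
      \<comment> \<open>A scalar \<open>a 0\<close> would satisfy the relation
        \<open>- a 0 + a 0 * 1 = 0\<close>.\<close>
      proof
        assume "a 0 \<in> K"
        then have "- a 0 \<in> K" by (rule K_uminus)
        moreover have "- a 0 + (\<Sum>i<n. a i * 1) = 0" using \<open>n = 1\<close> by simp
        ultimately have "(1::'r) = 0"
          using right_independentD[OF ind, of "- a 0" "\<lambda>_. 1" 0] \<open>n = 1\<close> KA[OF one_K] by simp
        then show False by simp
      qed
      then have "deg (a 0) > 0" using deg_eq_0 by (metis gr0I)
      moreover have "deg (a 0 * g 0) \<le> deg x"
        using deg_add[of x "- c"] deg_eq_0[of "- c"] K_uminus[OF c] x by simp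
      ultimately have "deg (g 0) < deg x" using deg_mult[OF nz] by simp
      then obtain N where "g 0 \<in> spanned a n N" using less.hyps g \<open>n = 1\<close> by blast
      then have "x \<in> spanned a n (Suc N)"
        unfolding spanned_Suc using c x \<open>n = 1\<close> by (intro bexI[of _ c] exI[of _ g]) auto
      then show ?thesis ..
    qed
  qed
qed

section \<open>Coding finite sets of pairs\<close>

text \<open>Congruence modulo the right ideal of \<open>q\<close>. For \<open>q = t - c\<close> it
  expresses that a polynomial in \<open>t\<close> with coefficients on the right takes a given value
  at \<open>c\<close>.\<close>

definition right_cong :: "'r \<Rightarrow> 'r \<Rightarrow> 'r \<Rightarrow> bool" where
  "right_cong q x y \<longleftrightarrow> (\<exists>p\<in>A. x - y = q * p)"

lemma right_cong_refl [simp]: "right_cong q x x"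
  using KA[OF zero_K] by (auto simp: right_cong_def intro!: bexI[of _ 0])

lemma right_cong_add:
  "right_cong q x y \<Longrightarrow> right_cong q x' y' \<Longrightarrow> right_cong q (x + x') (y + y')"
  unfolding right_cong_def
  by (metis A_add add_diff_add distrib_left)

lemma right_cong_diff:
  "right_cong q x y \<Longrightarrow> right_cong q x' y' \<Longrightarrow> right_cong q (x - x') (y - y')"
  unfolding right_cong_def
  by (metis A_diff diff_diff_eq2 diff_diff_add add_diff_eq right_diff_distrib diff_add_eq add.commute)

lemma right_cong_mult:
  "right_cong q x y \<Longrightarrow> z \<in> A \<Longrightarrow> right_cong q (x * z) (y * z)"
  unfolding right_cong_def by (metis A_mult left_diff_distrib mult.assoc)

lemma right_cong_sym: "right_cong q x y \<Longrightarrow> right_cong q y x"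
  using right_cong_diff[of q "x + y" "x + y" x y] by simp

lemma right_cong_trans: "right_cong q x y \<Longrightarrow> right_cong q y z \<Longrightarrow> right_cong q x z"
  using right_cong_add[of q x y y z] right_cong_diff[of q "x + y" "y + z" y y] by simp

text \<open>\<open>H\<close> is the product of the factors \<open>t - c\<close> with
  \<open>c \<in> C\<close>. Its value at another scalar \<open>d\<close> is the product of the
  scalars \<open>d - c\<close>, hence nonzero.\<close>

lemma exists_vanishing:
  assumes t: "t \<in> A" and "finite C" "C \<subseteq> K"
  shows "\<exists>H\<in>A. (\<forall>c\<in>C. right_cong (t - c) H 0) \<and>
    (\<forall>d\<in>K - C. \<exists>k\<in>K - {0}. right_cong (t - d) H k)"
  using assms(2,3)
proof (induction C rule: finite_induct)
  case empty
  have "1 \<in> K - {0}" using one_K by simp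
  moreover have "right_cong q 1 1" for q by simp
  ultimately show ?case using KA[OF one_K] by blast
next
  case (insert c C)
  then obtain H where H: "H \<in> A" "\<And>c. c \<in> C \<Longrightarrow> right_cong (t - c) H 0"
    "\<And>d. d \<in> K - C \<Longrightarrow> \<exists>k\<in>K - {0}. right_cong (t - d) H k" by auto
  have c: "c \<in> K" using insert.prems by simp
  have "right_cong (t - c) ((t - c) * H) 0"
    using H(1) by (auto simp: right_cong_def)
  moreover have "right_cong (t - b) ((t - c) * H) 0" if bC: "b \<in> C" for b
  proof -
    have b: "b \<in> K" using insert.prems bC by auto
    obtain p where p: "p \<in> A" "H = (t - b) * p"
      using H(2)[OF bC] by (auto simp: right_cong_def)
    \<comment> \<open>Both factors are polynomials in \<open>t\<close> with central coefficients, so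
      \<open>t - b\<close> can be brought to the front, where divisibility is tested.\<close>
    have "(t - c) * (t - b) = (t - b) * (t - c)"
      using K_central[OF c, of t] K_central[OF b, of t] K_central[OF b, of c] by (simp add: algebra_simps)
    then have "(t - c) * H = (t - b) * ((t - c) * p)"
      unfolding p(2) by (metis mult.assoc)
    then show ?thesis
      unfolding right_cong_def using p(1) t c by (auto simp: KA intro!: A_mult A_diff)
  qed
  moreover have "\<exists>k\<in>K - {0}. right_cong (t - d) ((t - c) * H) k" if d: "d \<in> K - insert c C" for d
  proof -
    obtain k where k: "k \<in> K - {0}" "right_cong (t - d) H k" using H(3) d by blast
    have dc: "d - c \<in> K" using d c K_diff by auto
    \<comment> \<open>Modulo \<open>t - d\<close> the new factor equals the scalar
      \<open>d - c\<close>; centrality moves it behind \<open>H\<close>, and the congruence for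
      \<open>H\<close> is then multiplied by it from the right.\<close>
    have "right_cong (t - d) (t - d) 0"
      using KA[OF one_K] by (auto simp: right_cong_def intro!: bexI[of _ 1])
    from right_cong_add[OF this right_cong_refl[of _ "d - c"]]
    have "right_cong (t - d) (t - c) (d - c)" by simp
    from right_cong_mult[OF this H(1)] have 1: "right_cong (t - d) ((t - c) * H) (H * (d - c))"
      by (simp only: K_central[OF dc, of H])
    have 2: "right_cong (t - d) (H * (d - c)) (k * (d - c))"
      using right_cong_mult[OF k(2) KA[OF dc]] .
    have "k * (d - c) \<in> K - {0}"
      using k dc d by (auto simp: K_mult no_zero_div)
    with right_cong_trans[OF 1 2] show ?thesis by blast
  qed
  ultimately show ?case
    using H(1) t c by (intro bexI[of _ "(t - c) * H"]) (auto simp: KA intro!: A_mult A_diff)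
qed

text \<open>Newton interpolation: a multiple of \<open>H\<close>, which vanishes on \<open>C\<close>, corrects the value at the new point.\<close>

lemma exists_interpolant:
  assumes t: "t \<in> A" and "finite C" "C \<subseteq> K" "\<forall>c\<in>C. y c \<in> A"
  shows "\<exists>G\<in>A. \<forall>c\<in>C. right_cong (t - c) G (y c)"
  using assms(2-4)
proof (induction C rule: finite_induct)
  case empty
  then show ?case using KA[OF zero_K] by blast
next
  case (insert c C)
  then obtain G where G: "G \<in> A" "\<forall>c\<in>C. right_cong (t - c) G (y c)" by auto
  have "C \<subseteq> K" using insert.prems by simp
  from exists_vanishing[OF t insert.hyps(1) this] obtain H where H: "H \<in> A"
    "\<And>c. c \<in> C \<Longrightarrow> right_cong (t - c) H 0"
    "\<And>d. d \<in> K - C \<Longrightarrow> \<exists>k\<in>K - {0}. right_cong (t - d) H k" by blast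
  have "c \<in> K - C" using insert by simp
  then obtain k where k: "k \<in> K - {0}" "right_cong (t - c) H k" using H(3) by blast
  then obtain l where l: "l \<in> K" "k * l = 1" using K_inverse by blast
  \<comment> \<open>Since \<open>H\<close> has value \<open>k\<close> at \<open>c\<close>, adding
    \<open>H * z\<close> corrects the value there from \<open>G\<close> to \<open>y c\<close> and
    changes nothing at the points of \<open>C\<close>.\<close>
  define z where "z = l * (y c - G)"
  have z: "z \<in> A" using l G insert.prems by (simp add: z_def A_mult A_diff KA)
  have kz: "k * z = y c - G" using l(2) by (simp add: z_def flip: mult.assoc)
  have "right_cong (t - c) (G + H * z) (y c)"
    using right_cong_add[OF right_cong_refl[of _ G] right_cong_mult[OF k(2) z]] by (simp add: kz)
  moreover have "right_cong (t - b) (G + H * z) (y b)" if "b \<in> C" for b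
    using right_cong_add[OF _ right_cong_mult[OF H(2)[OF that] z]] G(2) that by fastforce
  ultimately show ?case
    using G(1) H(1) z by (intro bexI[of _ "G + H * z"]) (auto intro!: A_add A_mult)
qed

text \<open>The zeros \<open>c \<in> K\<close> of \<open>H\<close>, as a polynomial in \<open>t\<close>, index the coded pairs \<open>(g, v)\<close>; the
  values at \<open>c\<close> of the polynomials \<open>G\<close> and \<open>G'\<close> in \<open>t\<close> are \<open>s * g\<close> and \<open>s * v\<close>.\<close>

definition coded :: "'r \<Rightarrow> 'r \<Rightarrow> 'r \<Rightarrow> 'r \<Rightarrow> 'r \<Rightarrow> 'r \<Rightarrow> 'r \<Rightarrow> bool" where
  "coded t s G G' H g v \<longleftrightarrow>
     (\<exists>c\<in>K. right_cong (t - c) H 0 \<and> right_cong (t - c) G (s * g) \<and> right_cong (t - c) G' (s * v))"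

section \<open>Coding and decoding with at least two independent entries\<close>

context
  fixes a n
  assumes a: "\<forall>i<n. a i \<in> A" and ind: "right_independent a n" and n: "2 \<le> n"
begin

lemma independent_not_const: "i < n \<Longrightarrow> a i \<notin> K"
proof
  assume i: "i < n" and "a i \<in> K"
  then have "- a i \<in> K" by (simp add: K_uminus)
  moreover have "- a i + (\<Sum>j<n. a j * (if j = i then 1 else 0)) = 0"
    using i by (simp add: if_distrib cong: if_cong)
  moreover have "\<forall>j<n. (if j = i then 1 else 0) \<in> A" by (simp add: KA one_K zero_K)
  ultimately have "(if i = i then 1 else 0) = (0::'r)"
    using right_independentD[OF ind _ _ _ i, where f = "\<lambda>j. if j = i then 1 else 0"] by blast
  then show False by simp
qed

text \<open>This is what makes decoding unambiguous. In \<open>a 0 * z - a 1 * y = c * z\<close>,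
  comparing the cofactors of \<open>a 0\<close> gives \<open>z = c * g 0\<close>, where
  \<open>g 0\<close> is the cofactor of \<open>a 0\<close> in \<open>z\<close> itself. So the word
  length needed for \<open>z\<close> drops until \<open>z\<close> is a scalar, and then the same
  equation gives \<open>z = 0\<close>.\<close>

lemma right_cancel_distinct_gen:
  assumes "c \<in> K" "z \<in> spanned a n N" "y \<in> A" "a 1 * y = (a 0 - c) * z"
  shows "z = 0"
  using assms
proof (induction N)
  case 0
  then have z: "z \<in> K" by (simp add: spanned_0)
  let ?f = "\<lambda>i. if i = 0 then z else if i = 1 then - y else 0"
  have "(\<Sum>i<n. a i * ?f i) = (\<Sum>i\<in>{0,1}. a i * ?f i)"
    using n by (intro sum.mono_neutral_right) auto
  also have "\<dots> = c * z"
    using 0 by (simp add: algebra_simps)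
  finally have "- (c * z) + (\<Sum>i<n. a i * ?f i) = 0" by simp
  moreover have "- (c * z) \<in> K" using 0 z by (auto intro!: K_uminus K_mult)
  moreover have "\<forall>i<n. ?f i \<in> A" using z 0 by (auto simp: KA zero_K intro!: A_uminus)
  ultimately have "?f 0 = 0"
    using right_independentD[OF ind, where f = ?f and i = 0] n by fastforce
  then show ?case by simp
next
  case (Suc N)
  obtain d g where d: "d \<in> K" and g: "\<forall>i<n. g i \<in> spanned a n N" and z: "z = d + (\<Sum>i<n. a i * g i)"
    using Suc.prems unfolding spanned_Suc by blast
  have gA: "\<forall>i<n. g i \<in> A" using g spanned_subset[OF a] by blast
  have zA: "z \<in> A" unfolding z using d gA a by (auto simp: KA intro!: A_add A_sum A_mult)
  let ?e = "\<lambda>i. if i = 0 then z else if i = 1 then - y else 0"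
  have "(\<Sum>i<n. a i * ?e i) = (\<Sum>i\<in>{0,1}. a i * ?e i)"
    using n by (intro sum.mono_neutral_right) auto
  also have "\<dots> = c * z"
    using Suc by (simp add: algebra_simps)
  also have "\<dots> = c * d + (\<Sum>i<n. a i * (c * g i))"
  proof -
    have "c * (a i * x) = a i * (c * x)" for i x
      using K_central[OF Suc.prems(1), of "a i"] by (metis mult.assoc)
    then show ?thesis by (simp add: z distrib_left sum_distrib_left)
  qed
  finally have "- (c * d) + (\<Sum>i<n. a i * (?e i - c * g i)) = 0"
    by (simp add: right_diff_distrib sum_subtractf)
  moreover have "- (c * d) \<in> K" using Suc d by (auto intro!: K_uminus K_mult)
  moreover have "\<forall>i<n. ?e i - c * g i \<in> A"
    using zA gA Suc.prems by (auto simp: KA zero_K intro!: A_diff A_uminus A_mult)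
  ultimately have "?e 0 - c * g 0 = 0"
    using right_independentD[OF ind, where f = "\<lambda>i. ?e i - c * g i" and i = 0] n by fastforce
  then have "z = c * g 0" by simp
  then have "z \<in> spanned a n N" using g n spanned_scale[OF Suc.prems(1)] by auto
  then show ?case using Suc by blast
qed

text \<open>The infinite field supplies one scalar index per pair. Among scalars, \<open>H\<close>
  vanishes exactly at these indices, and \<open>G\<close> and \<open>G'\<close> interpolate the two
  components multiplied by \<open>a 1\<close>.\<close>

lemma exists_code:
  assumes gen: "generating a n" and S: "finite S" "S \<subseteq> A \<times> A"
  shows "\<exists>G\<in>A. \<exists>G'\<in>A. \<exists>H\<in>A. \<forall>g\<in>A. \<forall>v\<in>A. coded (a 0) (a 1) G G' H g v \<longleftrightarrow> (g, v) \<in> S"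
proof -
  have t: "a 0 \<in> A" and s: "a 1 \<in> A" using a n by auto
  obtain C where C: "C \<subseteq> K" "finite C" "card C = card S"
    using infinite_arbitrarily_large[OF infinite_K] by metis
  then obtain \<pi> where \<pi>: "bij_betw \<pi> C S"
    using S(1) by (metis finite_same_card_bij)
  then have \<pi>S: "\<pi> c \<in> S" if "c \<in> C" for c using that by (auto simp: bij_betw_def)
  have "\<forall>c\<in>C. a 1 * fst (\<pi> c) \<in> A" "\<forall>c\<in>C. a 1 * snd (\<pi> c) \<in> A"
    using \<pi>S S(2) s by (fastforce intro!: A_mult)+
  from this[THEN exists_interpolant[OF t C(2,1)]]
  obtain G G' where G: "G \<in> A" "\<forall>c\<in>C. right_cong (a 0 - c) G (a 1 * fst (\<pi> c))"
    and G': "G' \<in> A" "\<forall>c\<in>C. right_cong (a 0 - c) G' (a 1 * snd (\<pi> c))"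
    by blast
  obtain H where H: "H \<in> A" "\<And>c. c \<in> C \<Longrightarrow> right_cong (a 0 - c) H 0"
    "\<And>d. d \<in> K - C \<Longrightarrow> \<exists>k\<in>K - {0}. right_cong (a 0 - d) H k"
    using exists_vanishing[OF t C(2,1)] by blast
  \<comment> \<open>At scalars outside \<open>C\<close> the value of \<open>H\<close> is a nonzero
    scalar, and by degrees such a scalar is no multiple of the nonconstant
    \<open>a 0 - c\<close>.\<close>
  have in_C: "c \<in> C" if c: "c \<in> K" "right_cong (a 0 - c) H 0" for c
  proof (rule ccontr)
    assume "c \<notin> C"
    then obtain k where k: "k \<in> K - {0}" "right_cong (a 0 - c) H k" using H(3) c by blast
    have "right_cong (a 0 - c) k 0" using right_cong_trans[OF right_cong_sym[OF k(2)] c(2)] .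
    then obtain p where p: "k = (a 0 - c) * p" by (auto simp: right_cong_def)
    then have "a 0 - c \<noteq> 0" "p \<noteq> 0" using k(1) by auto
    from deg_mult[OF this] have "deg (a 0 - c) = 0"
      using p k(1) deg_eq_0[of k] by simp
    then have "a 0 - c + c \<in> K" using deg_eq_0 c(1) K_add by blast
    then show False using independent_not_const[of 0] n by simp
  qed
  \<comment> \<open>Two values \<open>a 1 * x\<close> and \<open>a 1 * y\<close> at \<open>c\<close>
    differ by a multiple of \<open>a 0 - c\<close>, so \<open>right_cancel_distinct_gen\<close>
    applies; generation bounds the word length of the quotient \<open>p\<close>.\<close>
  have unique: "x = y" if xy: "c \<in> K" "x \<in> A" "y \<in> A" "right_cong (a 0 - c) Q (a 1 * x)" "right_cong (a 0 - c) Q (a 1 * y)"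
    for c x y Q
  proof -
    have "right_cong (a 0 - c) (a 1 * x) (a 1 * y)"
      using right_cong_trans[OF right_cong_sym] xy by blast
    then obtain p where p: "p \<in> A" "a 1 * (x - y) = (a 0 - c) * p"
      by (auto simp: right_cong_def right_diff_distrib)
    obtain N where "p \<in> spanned a n N" using gen p(1) by (auto simp: generating_def)
    then have "p = 0" using right_cancel_distinct_gen xy p A_diff by blast
    then have "a 1 * (x - y) = 0" using p by simp
    moreover have "a 1 \<noteq> 0" using independent_not_const[of 1] n zero_K by auto
    ultimately show ?thesis using no_zero_div by (metis eq_iff_diff_eq_0)
  qed
  have "coded (a 0) (a 1) G G' H g v \<longleftrightarrow> (g, v) \<in> S" if gv: "g \<in> A" "v \<in> A" for g v
  proof
    assume "coded (a 0) (a 1) G G' H g v"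
    then obtain c where c: "c \<in> K" "right_cong (a 0 - c) H 0"
      "right_cong (a 0 - c) G (a 1 * g)" "right_cong (a 0 - c) G' (a 1 * v)"
      by (auto simp: coded_def)
    have "c \<in> C" using in_C c by blast
    moreover from this have "fst (\<pi> c) \<in> A" "snd (\<pi> c) \<in> A" using \<pi>S S(2) by fastforce+
    ultimately have "g = fst (\<pi> c)" "v = snd (\<pi> c)" using unique c G(2) G'(2) gv by blast+
    then show "(g, v) \<in> S" using \<pi>S[OF \<open>c \<in> C\<close>] by simp
  next
    assume "(g, v) \<in> S"
    then obtain c where c: "c \<in> C" "\<pi> c = (g, v)" using \<pi> by (auto simp: bij_betw_def)
    have "right_cong (a 0 - c) G (a 1 * g)" "right_cong (a 0 - c) G' (a 1 * v)"
      using G(2) G'(2) c by force+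
    then show "coded (a 0) (a 1) G G' H g v"
      unfolding coded_def using H(2)[OF c(1)] c(1) C(1) by blast
  qed
  then show ?thesis using G(1) G'(1) H(1) by blast
qed

section \<open>Derivations with termination certificates\<close>

definition derivable_from :: "('r \<times> 'r) set \<Rightarrow> 'r \<times> 'r \<Rightarrow> bool" where
  "derivable_from S = (\<lambda>(g, v). g \<in> A \<and> v \<in> A \<and> v \<noteq> 0 \<and>
    (g \<in> K \<or> (\<exists>v'. \<exists>c\<in>K. \<exists>h. v = a 0 * v' \<and> g = c + (\<Sum>i<n. a i * h i) \<and> (\<forall>i<n. (h i, v') \<in> S))))"

lemma derivable_from_mono: "derivable_from S p \<Longrightarrow> S \<subseteq> T \<Longrightarrow> derivable_from T p"
  by (cases p) (force simp: derivable_from_def)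

text \<open>A bound \<open>m\<close> on word length gives the certificate \<open>a 0 ^ m\<close>,
  and all cofactors of a decomposition share the next lower power. The derivations of the finitely
  many cofactors are united and the new pair is added.\<close>

lemma exists_derivation:
  assumes "f \<in> spanned a n m"
  shows "\<exists>S. finite S \<and> (f, a 0 ^ m) \<in> S \<and> (\<forall>p\<in>S. derivable_from S p)"
  using assms
proof (induction m arbitrary: f)
  case 0
  then show ?case using KA one_K
    by (intro exI[of _ "{(f, 1)}"]) (auto simp: spanned_0 derivable_from_def)
next
  case (Suc m)
  have f: "f \<in> A" using spanned_subset[OF a] Suc.prems by blast
  have t: "a 0 \<in> A" "a 0 \<noteq> 0" using a n independent_not_const[of 0] zero_K by auto
  obtain c g where c: "c \<in> K" and g: "\<forall>i<n. g i \<in> spanned a n m" and fe: "f = c + (\<Sum>i<n. a i * g i)"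
    using Suc.prems unfolding spanned_Suc by blast
  have "\<forall>i. \<exists>S. i < n \<longrightarrow> finite S \<and> (g i, a 0 ^ m) \<in> S \<and> (\<forall>p\<in>S. derivable_from S p)"
    using Suc.IH g by blast
  then obtain T where T: "\<And>i. i < n \<Longrightarrow> finite (T i) \<and> (g i, a 0 ^ m) \<in> T i \<and> (\<forall>p\<in>T i. derivable_from (T i) p)"
    by metis
  define S where "S = insert (f, a 0 ^ Suc m) (\<Union>i<n. T i)"
  have "derivable_from S p" if i: "i < n" "p \<in> T i" for p i
  proof (rule derivable_from_mono)
    show "derivable_from (T i) p" using T[OF i(1)] i(2) by blast
    show "T i \<subseteq> S" using i(1) by (auto simp: S_def)
  qed
  moreover have "derivable_from S (f, a 0 ^ Suc m)"
  proof -
    have "a 0 ^ Suc m = a 0 * a 0 ^ m" by simp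
    moreover have "\<forall>i<n. (g i, a 0 ^ m) \<in> S" using T by (auto simp: S_def)
    ultimately show ?thesis
      unfolding derivable_from_def
      using f A_power[OF t(1), of "Suc m"] power_nonzero[OF t(2), of "Suc m"] c fe by blast
  qed
  ultimately have "\<forall>p\<in>S. derivable_from S p" unfolding S_def by blast
  moreover have "finite S" using T by (auto simp: S_def)
  moreover have "(f, a 0 ^ Suc m) \<in> S" by (simp add: S_def)
  ultimately show ?case by blast
qed

text \<open>Forward, a code of a finite derivation of \<open>f\<close> is a witness. Conversely,
  whatever pairs \<open>G\<close>, \<open>G'\<close>, \<open>H\<close> code, induction on the degree
  of the certificate \<open>v\<close> shows that each coded \<open>g\<close> is a combination of
  words.\<close>

theorem generating_iff_coded:
  "generating a n \<longleftrightarrow>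
    (\<forall>f\<in>A. \<exists>G\<in>A. \<exists>G'\<in>A. \<exists>H\<in>A. \<exists>u\<in>A. coded (a 0) (a 1) G G' H f u \<and>
      (\<forall>g\<in>A. \<forall>v\<in>A. coded (a 0) (a 1) G G' H g v \<longrightarrow> v \<noteq> 0 \<and>
        (g \<in> K \<or> (\<exists>v'\<in>A. \<exists>c\<in>K. \<exists>h. (\<forall>i<n. h i \<in> A) \<and> v = a 0 * v' \<and>
          g = c + (\<Sum>i<n. a i * h i) \<and> (\<forall>i<n. coded (a 0) (a 1) G G' H (h i) v')))))"
  (is "_ \<longleftrightarrow> (\<forall>f\<in>A. \<exists>G\<in>A. \<exists>G'\<in>A. \<exists>H\<in>A. \<exists>u\<in>A. coded _ _ G G' H f u \<and> ?Q G G' H)")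
proof
  assume gen: "generating a n"
  show "\<forall>f\<in>A. \<exists>G\<in>A. \<exists>G'\<in>A. \<exists>H\<in>A. \<exists>u\<in>A. coded (a 0) (a 1) G G' H f u \<and> ?Q G G' H"
  proof
    fix f assume "f \<in> A"
    then obtain m where m: "f \<in> spanned a n m" using gen by (auto simp: generating_def)
    obtain S where S: "finite S" "(f, a 0 ^ m) \<in> S" and der: "\<forall>p\<in>S. derivable_from S p"
      using exists_derivation[OF m] by blast
    have SA: "\<And>g v. (g, v) \<in> S \<Longrightarrow> g \<in> A \<and> v \<in> A \<and> v \<noteq> 0"
      and step: "\<And>g v. (g, v) \<in> S \<Longrightarrow> g \<in> K \<or> (\<exists>v'. \<exists>c\<in>K. \<exists>h. v = a 0 * v' \<and>
        g = c + (\<Sum>i<n. a i * h i) \<and> (\<forall>i<n. (h i, v') \<in> S))"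
      using der unfolding derivable_from_def by fast+
    obtain G G' H where GH: "G \<in> A" "G' \<in> A" "H \<in> A"
      and code: "\<And>g v. g \<in> A \<Longrightarrow> v \<in> A \<Longrightarrow> coded (a 0) (a 1) G G' H g v \<longleftrightarrow> (g, v) \<in> S"
      using exists_code[OF gen S(1)] SA by (metis mem_Sigma_iff subrelI)
    have "?Q G G' H"
    proof (intro ballI impI)
      fix g v assume gv: "g \<in> A" "v \<in> A" "coded (a 0) (a 1) G G' H g v"
      then have inS: "(g, v) \<in> S" using code by blast
      have "v' \<in> A \<and> (\<forall>i<n. h i \<in> A \<and> coded (a 0) (a 1) G G' H (h i) v')"
        \<comment> \<open>Membership of \<open>v'\<close> in \<open>A\<close> is read off from the
          pair \<open>(h 0, v')\<close>, which is available because \<open>n\<close> is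
          positive.\<close>
        if "\<forall>i<n. (h i, v') \<in> S" for h v'
        using that SA code n by (metis less_le_trans zero_less_numeral)
      note sub = this
      have "\<exists>v'\<in>A. \<exists>c\<in>K. \<exists>h. (\<forall>i<n. h i \<in> A) \<and> v = a 0 * v' \<and>
          g = c + (\<Sum>i<n. a i * h i) \<and> (\<forall>i<n. coded (a 0) (a 1) G G' H (h i) v')" if "g \<notin> K"
      proof -
        from step[OF inS] that obtain v' c h where
          h: "c \<in> K" "v = a 0 * v'" "g = c + (\<Sum>i<n. a i * h i)" "\<forall>i<n. (h i, v') \<in> S" by auto
        show ?thesis
          using h(1-3) sub[OF h(4)] by (intro bexI[of _ v'] bexI[of _ c] exI[of _ h]) simp_all
      qed
      then show "v \<noteq> 0 \<and>
        (g \<in> K \<or> (\<exists>v'\<in>A. \<exists>c\<in>K. \<exists>h. (\<forall>i<n. h i \<in> A) \<and> v = a 0 * v' \<and>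
          g = c + (\<Sum>i<n. a i * h i) \<and> (\<forall>i<n. coded (a 0) (a 1) G G' H (h i) v')))"
        using SA[OF inS] by blast
    qed
    moreover have "coded (a 0) (a 1) G G' H f (a 0 ^ m)" "a 0 ^ m \<in> A"
      using code S(2) SA by blast+
    ultimately show "\<exists>G\<in>A. \<exists>G'\<in>A. \<exists>H\<in>A. \<exists>u\<in>A. coded (a 0) (a 1) G G' H f u \<and> ?Q G G' H"
      using GH by blast
  qed
next
  assume R: "\<forall>f\<in>A. \<exists>G\<in>A. \<exists>G'\<in>A. \<exists>H\<in>A. \<exists>u\<in>A. coded (a 0) (a 1) G G' H f u \<and> ?Q G G' H"
  show "generating a n"
    unfolding generating_def
  proof
    fix f assume f: "f \<in> A"
    then obtain G G' H u where u: "u \<in> A" "coded (a 0) (a 1) G G' H f u" and Q: "?Q G G' H"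
      using R by blast
    have "\<exists>N. g \<in> spanned a n N" if "g \<in> A" "v \<in> A" "coded (a 0) (a 1) G G' H g v" for g v
      using that
    proof (induction "deg v" arbitrary: g v rule: less_induct)
      case less
      show ?case
      proof (cases "g \<in> K")
        case True
        then show ?thesis using spanned_0 by blast
      next
        case False
        with mp[OF bspec[OF bspec[OF Q less.prems(1)] less.prems(2)] less.prems(3)]
        obtain v' c h where v': "v' \<in> A" "v = a 0 * v'" and c: "c \<in> K" and h: "\<forall>i<n. h i \<in> A"
          and g: "g = c + (\<Sum>i<n. a i * h i)" and co: "\<forall>i<n. coded (a 0) (a 1) G G' H (h i) v'"
          and "v \<noteq> 0"
          by auto
        \<comment> \<open>As \<open>v\<close> is nonzero and \<open>a 0\<close> is not a scalar,
          passing from \<open>v\<close> to \<open>v'\<close> strictly lowers the degree.\<close>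
        have "a 0 \<noteq> 0" "v' \<noteq> 0" using v'(2) \<open>v \<noteq> 0\<close> by auto
        then have "deg v = deg (a 0) + deg v'" using deg_mult v'(2) by simp
        moreover have "deg (a 0) \<noteq> 0" using independent_not_const[of 0] n deg_eq_0 by simp
        ultimately have "\<forall>i<n. \<exists>N. h i \<in> spanned a n N"
          using less.hyps[of v'] h co v'(1) by simp
        then obtain N where "\<forall>i<n. h i \<in> spanned a n N" using spanned_common by blast
        then have "g \<in> spanned a n (Suc N)" unfolding spanned_Suc using c g by blast
        then show ?thesis ..
      qed
    qed
    then show "\<exists>N. f \<in> spanned a n N" using f u by blast
  qed
qed

end

end

section \<open>First-order formulas\<close>

definition FOr :: "ring_formula \<Rightarrow> ring_formula \<Rightarrow> ring_formula" where
  "FOr f g = FNot (FAnd (FNot f) (FNot g))"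

definition FImp :: "ring_formula \<Rightarrow> ring_formula \<Rightarrow> ring_formula" where
  "FImp f g = FNot (FAnd f (FNot g))"

definition FAll :: "nat \<Rightarrow> ring_formula \<Rightarrow> ring_formula" where
  "FAll i f = FNot (FEx i (FNot f))"

primrec FConj :: "nat \<Rightarrow> (nat \<Rightarrow> ring_formula) \<Rightarrow> ring_formula" where
  "FConj 0 f = FEq TZero TZero"
| "FConj (Suc k) f = FAnd (FConj k f) (f k)"

primrec FExs :: "nat \<Rightarrow> nat \<Rightarrow> ring_formula \<Rightarrow> ring_formula" where
  "FExs m 0 f = f"
| "FExs m (Suc k) f = FExs m k (FEx (m + k) f)"

primrec TSum :: "nat \<Rightarrow> (nat \<Rightarrow> ring_term) \<Rightarrow> ring_term" where
  "TSum 0 t = TZero"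
| "TSum (Suc k) t = TAdd (TSum k t) (t k)"

text \<open>The environment reached once the quantifier block \<open>FExs m k\<close> has chosen the
  values \<open>h\<close>.\<close>

definition block_update :: "(nat \<Rightarrow> 'r) \<Rightarrow> nat \<Rightarrow> nat \<Rightarrow> (nat \<Rightarrow> 'r) \<Rightarrow> nat \<Rightarrow> 'r" where
  "block_update e m k h = (\<lambda>j. if m \<le> j \<and> j < m + k then h (j - m) else e j)"

lemma free_vars_derived [simp]:
  "free_vars (FOr f g) = free_vars f \<union> free_vars g"
  "free_vars (FImp f g) = free_vars f \<union> free_vars g"
  "free_vars (FAll i f) = free_vars f - {i}"
  by (simp_all add: FOr_def FImp_def FAll_def)

lemma free_vars_FConj [simp]: "free_vars (FConj k F) = (\<Union>i<k. free_vars (F i))"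
  by (induction k) (auto simp: lessThan_Suc)

lemma free_vars_FExs [simp]: "free_vars (FExs m k f) = free_vars f - {m..<m + k}"
  by (induction k arbitrary: f) auto

lemma term_vars_TSum [simp]: "term_vars (TSum k t) = (\<Union>i<k. term_vars (t i))"
  by (induction k) (auto simp: lessThan_Suc)

lemma satisfies_derived [simp]:
  "satisfies A e (FOr f g) \<longleftrightarrow> satisfies A e f \<or> satisfies A e g"
  "satisfies A e (FImp f g) \<longleftrightarrow> (satisfies A e f \<longrightarrow> satisfies A e g)"
  "satisfies A e (FAll i f) \<longleftrightarrow> (\<forall>a\<in>A. satisfies A (e(i := a)) f)"
  by (simp_all add: FOr_def FImp_def FAll_def)

lemma satisfies_FConj [simp]: "satisfies A e (FConj k F) \<longleftrightarrow> (\<forall>i<k. satisfies A e (F i))"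
  by (induction k) (auto simp: less_Suc_eq)

lemma term_val_TSum [simp]: "term_val e (TSum k t) = (\<Sum>i<k. term_val e (t i))"
  by (induction k) (auto simp: lessThan_Suc add.commute)

lemma satisfies_FExs [simp]:
  "satisfies A e (FExs m k f) \<longleftrightarrow>
    (\<exists>h. (\<forall>i<k. h i \<in> A) \<and> satisfies A (block_update e m k h) f)"
proof (induction k arbitrary: f)
  case 0
  have "block_update e m 0 h = e" for h by (auto simp: block_update_def fun_eq_iff)
  then show ?case by simp
next
  case (Suc k)
  have upd: "(block_update e m k h)(m + k := x) = block_update e m (Suc k) (h(k := x))" for h x
    by (auto simp: block_update_def fun_eq_iff)
  have "satisfies A e (FExs m (Suc k) f) \<longleftrightarrow>
    (\<exists>h. (\<forall>i<k. h i \<in> A) \<and> (\<exists>x\<in>A. satisfies A (block_update e m (Suc k) (h(k := x))) f))"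
    by (simp add: Suc.IH upd)
  also have "\<dots> \<longleftrightarrow> (\<exists>h. (\<forall>i<Suc k. h i \<in> A) \<and> satisfies A (block_update e m (Suc k) h) f)"
    (is "?L \<longleftrightarrow> ?R")
  proof
    assume ?L
    then obtain h x where h: "\<forall>i<k. h i \<in> A" "x \<in> A"
      "satisfies A (block_update e m (Suc k) (h(k := x))) f" by blast
    then have "\<forall>i<Suc k. (h(k := x)) i \<in> A" by (simp add: less_Suc_eq)
    with h(3) show ?R by blast
  next
    assume ?R
    then obtain h where h: "\<forall>i<Suc k. h i \<in> A" "satisfies A (block_update e m (Suc k) h) f" by blast
    moreover have "h(k := h k) = h" by simp
    ultimately show ?L by (intro exI[of _ h]) (auto intro!: bexI[of _ "h k"])
  qed
  finally show ?case .
qed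

section \<open>The defining formulas\<close>

definition scalar_fm :: "nat \<Rightarrow> nat \<Rightarrow> ring_formula" where
  "scalar_fm i y = FOr (FEq (TVar i) TZero) (FEx y (FEq (TMul (TVar i) (TVar y)) TOne))"

definition comb_tm :: "nat \<Rightarrow> nat \<Rightarrow> nat \<Rightarrow> ring_term" where
  "comb_tm n c h = TAdd (TVar c) (TSum n (\<lambda>i. TMul (TVar i) (TVar (h + i))))"

text \<open>Index \<open>n\<close> holds \<open>c\<close> and the block from \<open>n + 1\<close>
  holds the \<open>f i\<close>. Index \<open>n + 1\<close> also serves for the inverse of
  \<open>c\<close>, whose quantifier is closed before the block opens.\<close>

definition independent_fm :: "nat \<Rightarrow> ring_formula" where
  "independent_fm n = FNot (FEx n (FAnd (scalar_fm n (n + 1)) (FExs (n + 1) n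
     (FAnd (FEq (comb_tm n n (n + 1)) TZero)
       (FNot (FConj n (\<lambda>i. FEq (TVar (n + 1 + i)) TZero)))))))"

definition decompose_fm :: "nat \<Rightarrow> ring_formula" where
  "decompose_fm n = FAll n (FEx (n + 1) (FAnd (scalar_fm (n + 1) (n + 2))
     (FExs (n + 2) n (FEq (TVar n) (comb_tm n (n + 1) (n + 2))))))"

text \<open>\<open>x - y = (t - c) * p\<close> is rendered as \<open>x + c * p = y + t * p\<close>.\<close>

definition cong_fm :: "nat \<Rightarrow> ring_term \<Rightarrow> ring_term \<Rightarrow> nat \<Rightarrow> ring_formula" where
  "cong_fm c x y p = FEx p (FEq (TAdd x (TMul (TVar c) (TVar p))) (TAdd y (TMul (TVar 0) (TVar p))))"

text \<open>Index \<open>c\<close> is meant to lie above all the others; then \<open>c + 1\<close>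
  is fresh too, and each conjunct binds it anew for an inverse or a quotient.\<close>

definition coded_fm :: "nat \<Rightarrow> nat \<Rightarrow> nat \<Rightarrow> nat \<Rightarrow> nat \<Rightarrow> nat \<Rightarrow> ring_formula" where
  "coded_fm G G' H g v c = FEx c (FAnd (scalar_fm c (c + 1))
     (FAnd (cong_fm c (TVar H) TZero (c + 1))
       (FAnd (cong_fm c (TVar G) (TMul (TVar 1) (TVar g)) (c + 1))
         (cong_fm c (TVar G') (TMul (TVar 1) (TVar v)) (c + 1)))))"

text \<open>Variables: \<open>0, \<dots>, n - 1\<close> are the candidate basis, \<open>n\<close> is \<open>f\<close>, \<open>n + 1, n + 2, n + 3\<close> are
  \<open>G, G', H\<close>, \<open>n + 4\<close> is the partner of \<open>f\<close>, \<open>n + 5, n + 6\<close> are a coded pair \<open>g, v\<close>,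
  \<open>n + 7\<close> is \<open>v'\<close>, \<open>n + 8\<close> is \<open>c\<close>, and the block from \<open>n + 9\<close> holds \<open>h 0, \<dots>, h (n - 1)\<close>.\<close>

definition step_fm :: "nat \<Rightarrow> ring_formula" where
  "step_fm n = FEx (n + 7) (FEx (n + 8) (FAnd (scalar_fm (n + 8) (n + 9)) (FExs (n + 9) n
     (FAnd (FEq (TVar (n + 6)) (TMul (TVar 0) (TVar (n + 7))))
       (FAnd (FEq (TVar (n + 5)) (comb_tm n (n + 8) (n + 9)))
         (FConj n (\<lambda>i. coded_fm (n + 1) (n + 2) (n + 3) (n + 9 + i) (n + 7) (2 * n + 9))))))))"

text \<open>Each \<open>coded_fm\<close> closes its own bound variables, so their indices are
  reused: \<open>n + 5\<close> and \<open>n + 6\<close> for \<open>g\<close> and \<open>v\<close>,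
  \<open>n + 7\<close> and \<open>n + 8\<close> inside \<open>step_fm\<close>.\<close>

definition generating_fm :: "nat \<Rightarrow> ring_formula" where
  "generating_fm n = FAll n (FEx (n + 1) (FEx (n + 2) (FEx (n + 3) (FEx (n + 4)
     (FAnd (coded_fm (n + 1) (n + 2) (n + 3) n (n + 4) (n + 5))
       (FAll (n + 5) (FAll (n + 6) (FImp (coded_fm (n + 1) (n + 2) (n + 3) (n + 5) (n + 6) (n + 7))
         (FAnd (FNot (FEq (TVar (n + 6)) TZero))
           (FOr (scalar_fm (n + 5) (n + 7)) (step_fm n)))))))))))"

lemmas fm_defs = scalar_fm_def comb_tm_def independent_fm_def decompose_fm_def cong_fm_def
  coded_fm_def step_fm_def generating_fm_def

lemma free_vars_independent_fm: "free_vars (independent_fm n) \<subseteq> {..<n}"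
  by (auto simp: fm_defs)

lemma free_vars_decompose_fm: "free_vars (decompose_fm n) \<subseteq> {..<n}"
  by (auto simp: fm_defs)

lemma free_vars_coded_fm: "free_vars (coded_fm G G' H g v c) \<subseteq> {0, 1, G, G', H, g, v}"
  by (auto simp: fm_defs)

text \<open>The variables 0 and 1, which the coding always mentions, are candidate basis elements
  once \<open>n\<close> is at least 2.\<close>

lemma free_vars_step_fm:
  assumes "2 \<le> n"
  shows "free_vars (step_fm n) \<subseteq> {..<n} \<union> {n + 1, n + 2, n + 3, n + 5, n + 6}"
proof -
  have "free_vars (FConj n (\<lambda>i. coded_fm (n + 1) (n + 2) (n + 3) (n + 9 + i) (n + 7) (2 * n + 9)))
    \<subseteq> {0, 1, n + 1, n + 2, n + 3, n + 7} \<union> {n + 9..<n + 9 + n}"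
    unfolding free_vars_FConj using free_vars_coded_fm by fastforce
  then show ?thesis
    using assms unfolding step_fm_def comb_tm_def scalar_fm_def by auto
qed

lemma free_vars_generating_fm:
  assumes "2 \<le> n"
  shows "free_vars (generating_fm n) \<subseteq> {..<n}"
proof -
  note free_vars_step_fm[OF assms]
    free_vars_coded_fm[of "n + 1" "n + 2" "n + 3" n "n + 4" "n + 5"]
    free_vars_coded_fm[of "n + 1" "n + 2" "n + 3" "n + 5" "n + 6" "n + 7"]
  then show ?thesis
    using assms unfolding generating_fm_def scalar_fm_def by auto
qed

section \<open>Meaning of the formulas\<close>

context degree_domain
begin

lemma satisfies_scalar_fm:
  "i \<noteq> y \<Longrightarrow> e i \<in> A \<Longrightarrow> satisfies A e (scalar_fm i y) \<longleftrightarrow> e i \<in> K"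
  by (simp add: scalar_fm_def in_K_iff_unit)

text \<open>Every quantified scalar enters the formulas through this guarded pattern.\<close>

lemma satisfies_ex_scalar:
  "i \<noteq> y \<Longrightarrow> satisfies A e (FEx i (FAnd (scalar_fm i y) f)) \<longleftrightarrow> (\<exists>c\<in>K. satisfies A (e(i := c)) f)"
  using KA by (auto simp: satisfies_scalar_fm)

lemma satisfies_independent_fm:
  "satisfies A e (independent_fm n) \<longleftrightarrow> right_independent e n"
proof -
  have "satisfies A (block_update (e(n := c)) (n + 1) n h) (FAnd (FEq (comb_tm n n (n + 1)) TZero)
       (FNot (FConj n (\<lambda>i. FEq (TVar (n + 1 + i)) TZero)))) \<longleftrightarrow>
     c + (\<Sum>i<n. e i * h i) = 0 \<and> \<not> (\<forall>i<n. h i = 0)" for c h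
    by (simp add: comb_tm_def block_update_def cong: sum.cong_simp)
  note fm = this
  have "n \<noteq> n + 1" by simp
  from satisfies_ex_scalar[OF this] show ?thesis
    unfolding independent_fm_def satisfies.simps(2) right_independent_def
    by (simp only: satisfies_FExs fm) blast
qed

lemma satisfies_decompose_fm:
  "satisfies A e (decompose_fm n) \<longleftrightarrow>
    (\<forall>x\<in>A. \<exists>c\<in>K. \<exists>g. (\<forall>i<n. g i \<in> A) \<and> x = c + (\<Sum>i<n. e i * g i))"
proof -
  have "satisfies A (block_update (e(n := x, n + 1 := c)) (n + 2) n h)
      (FEq (TVar n) (comb_tm n (n + 1) (n + 2))) \<longleftrightarrow> x = c + (\<Sum>i<n. e i * h i)" for x c h
    by (simp add: comb_tm_def block_update_def cong: sum.cong_simp)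
  note fm = this
  have "n + 1 \<noteq> n + 2" by simp
  from satisfies_ex_scalar[OF this] show ?thesis
    unfolding decompose_fm_def satisfies_derived by (simp only: satisfies_FExs fm)
qed

lemma satisfies_cong_fm:
  assumes "p \<noteq> c" "p \<noteq> 0" "p \<notin> term_vars x" "p \<notin> term_vars y"
  shows "satisfies A e (cong_fm c x y p) \<longleftrightarrow> right_cong (e 0 - e c) (term_val e x) (term_val e y)"
proof -
  have upd: "term_val (e(p := b)) s = term_val e s" if "p \<notin> term_vars s" for b s
    using that by (induction s) auto
  have "x + c * p = y + t * p \<longleftrightarrow> x - y = (t - c) * p" for x y c t p :: 'r
    by (auto simp: algebra_simps)
  then show ?thesis
    using assms by (simp add: cong_fm_def right_cong_def upd)
qed

lemma satisfies_coded_fm: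
  assumes "1 < c" "G < c" "G' < c" "H < c" "g < c" "v < c"
  shows "satisfies A e (coded_fm G G' H g v c) \<longleftrightarrow>
    coded (e 0) (e 1) (e G) (e G') (e H) (e g) (e v)"
  unfolding coded_fm_def coded_def
  using assms by (subst satisfies_ex_scalar) (auto simp: satisfies_cong_fm)

lemma satisfies_step_fm:
  assumes "2 \<le> n"
  shows "satisfies A e (step_fm n) \<longleftrightarrow>
    (\<exists>v'\<in>A. \<exists>c\<in>K. \<exists>h. (\<forall>i<n. h i \<in> A) \<and> e (n + 6) = e 0 * v' \<and>
      e (n + 5) = c + (\<Sum>i<n. e i * h i) \<and>
      (\<forall>i<n. coded (e 0) (e 1) (e (n + 1)) (e (n + 2)) (e (n + 3)) (h i) v'))"
proof -
  have "satisfies A (block_update (e(n + 7 := v', n + 8 := c)) (n + 9) n h)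
     (FAnd (FEq (TVar (n + 6)) (TMul (TVar 0) (TVar (n + 7))))
       (FAnd (FEq (TVar (n + 5)) (comb_tm n (n + 8) (n + 9)))
         (FConj n (\<lambda>i. coded_fm (n + 1) (n + 2) (n + 3) (n + 9 + i) (n + 7) (2 * n + 9))))) \<longleftrightarrow>
      e (n + 6) = e 0 * v' \<and> e (n + 5) = c + (\<Sum>i<n. e i * h i) \<and>
      (\<forall>i<n. coded (e 0) (e 1) (e (n + 1)) (e (n + 2)) (e (n + 3)) (h i) v')" for v' c h
    using assms by (simp add: comb_tm_def block_update_def satisfies_coded_fm cong: sum.cong_simp)
  note fm = this
  have "n + 8 \<noteq> n + 9" by simp
  from satisfies_ex_scalar[OF this] show ?thesis
    unfolding step_fm_def by (subst satisfies.simps(4)) (simp only: satisfies_FExs fm)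
qed

lemma satisfies_generating_fm:
  assumes "2 \<le> n"
  shows "satisfies A e (generating_fm n) \<longleftrightarrow>
    (\<forall>f\<in>A. \<exists>G\<in>A. \<exists>G'\<in>A. \<exists>H\<in>A. \<exists>u\<in>A. coded (e 0) (e 1) G G' H f u \<and>
      (\<forall>g\<in>A. \<forall>v\<in>A. coded (e 0) (e 1) G G' H g v \<longrightarrow> v \<noteq> 0 \<and>
        (g \<in> K \<or> (\<exists>v'\<in>A. \<exists>c\<in>K. \<exists>h. (\<forall>i<n. h i \<in> A) \<and> v = e 0 * v' \<and>
          g = c + (\<Sum>i<n. e i * h i) \<and> (\<forall>i<n. coded (e 0) (e 1) G G' H (h i) v')))))"
  unfolding generating_fm_def
  using assms
  by (simp add: satisfies_coded_fm satisfies_step_fm satisfies_scalar_fm cong: sum.cong_simp)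

text \<open>Coding takes both \<open>a 0\<close> and \<open>a 1\<close>; for
  \<open>n \<le> 1\<close> decomposability replaces it. There it yields generation only together
  with independence: for \<open>n = 1\<close> and \<open>a 0 = 1\<close> every element
  decomposes.\<close>

lemma generating_definable:
  "\<exists>Gen. free_vars Gen \<subseteq> {..<n} \<and> (\<forall>a. (\<forall>i<n. a i \<in> A) \<longrightarrow>
    (satisfies A a Gen \<longleftrightarrow> right_independent a n \<and> generating a n))"
proof (cases "2 \<le> n")
  case True
  show ?thesis
  proof (intro exI conjI allI impI)
    show "free_vars (FAnd (independent_fm n) (generating_fm n)) \<subseteq> {..<n}"
      using free_vars_independent_fm free_vars_generating_fm[OF True] by simp
    fix a :: "nat \<Rightarrow> 'r" assume "\<forall>i<n. a i \<in> A"
    then show "satisfies A a (FAnd (independent_fm n) (generating_fm n)) \<longleftrightarrow>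
        right_independent a n \<and> generating a n"
      unfolding satisfies.simps(3) satisfies_independent_fm satisfies_generating_fm[OF True]
      using generating_iff_coded[OF _ _ True] by blast
  qed
next
  case False
  show ?thesis
  proof (intro exI conjI allI impI)
    show "free_vars (FAnd (independent_fm n) (decompose_fm n)) \<subseteq> {..<n}"
      using free_vars_independent_fm free_vars_decompose_fm by simp
    fix a :: "nat \<Rightarrow> 'r" assume a: "\<forall>i<n. a i \<in> A"
    show "satisfies A a (FAnd (independent_fm n) (decompose_fm n)) \<longleftrightarrow>
        right_independent a n \<and> generating a n"
      unfolding satisfies.simps(3) satisfies_independent_fm satisfies_decompose_fm
    proof
      assume "right_independent a n \<and> (\<forall>x\<in>A. \<exists>c\<in>K. \<exists>g. (\<forall>i<n. g i \<in> A) \<and> x = c + (\<Sum>i<n. a i * g i))"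
      then show "right_independent a n \<and> generating a n"
        using generating_singleton[of a n] a False by simp
    next
      assume "right_independent a n \<and> generating a n"
      then show "right_independent a n \<and> (\<forall>x\<in>A. \<exists>c\<in>K. \<exists>g. (\<forall>i<n. g i \<in> A) \<and> x = c + (\<Sum>i<n. a i * g i))"
        using generating_decompose[of a n] a by simp
    qed
  qed
qed

end

section \<open>The free algebra\<close>

text \<open>The inserted 0 gives the zero element degree 0, in line with 0 being a scalar.\<close>

definition word_degree :: "('x free_monoid \<Rightarrow>\<^sub>0 'k::field) \<Rightarrow> nat" where
  "word_degree p = Max (insert 0 ((\<lambda>w. length (letters w)) ` Poly_Mapping.keys p))"

lemma word_degree_ge: "w \<in> Poly_Mapping.keys p \<Longrightarrow> length (letters w) \<le> word_degree p"
  by (simp add: word_degree_def)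

lemma word_degree_le_iff: "word_degree p \<le> d \<longleftrightarrow> (\<forall>w\<in>Poly_Mapping.keys p. length (letters w) \<le> d)"
  by (simp add: word_degree_def)

lemma word_degree_attained:
  assumes "p \<noteq> 0"
  shows "\<exists>w\<in>Poly_Mapping.keys p. length (letters w) = word_degree p"
proof -
  let ?L = "(\<lambda>w. length (letters w)) ` Poly_Mapping.keys p"
  have ne: "?L \<noteq> {}" using assms by simp
  then have "word_degree p = Max ?L" by (simp add: word_degree_def)
  then have "word_degree p \<in> ?L" using Max_in[OF _ ne] by simp
  then show ?thesis by auto
qed

lemma length_letters_plus: "length (letters (u + v)) = length (letters u) + length (letters v)"
  by (simp add: plus_free_monoid_def)

lemma plus_free_monoid_cancel:
  assumes "u' + v' = u + v" "length (letters u') = length (letters u)"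
  shows "u' = u \<and> v' = v"
  using assms by (cases u; cases v; cases u'; cases v') (auto simp: plus_free_monoid_def)

lemma sum_singles: "(\<Sum>w\<in>Poly_Mapping.keys p. Poly_Mapping.single w (Poly_Mapping.lookup p w)) = p"
  by (intro poly_mapping_eqI) (simp add: lookup_sum lookup_single when_def in_keys_iff)

text \<open>As \<open>u\<close> and \<open>v\<close> have maximal length, a factorization of
  \<open>u + v\<close> into words from the two supports must cut at the same place, so a single term
  contributes.\<close>

lemma lookup_mult_leading:
  fixes p q :: "'x free_monoid \<Rightarrow>\<^sub>0 'k::field"
  assumes u: "u \<in> Poly_Mapping.keys p" "length (letters u) = word_degree p"
    and v: "v \<in> Poly_Mapping.keys q" "length (letters v) = word_degree q"
  shows "Poly_Mapping.lookup (p * q) (u + v) = Poly_Mapping.lookup p u * Poly_Mapping.lookup q v"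
proof -
  have "p * q = (\<Sum>x\<in>Poly_Mapping.keys p. Poly_Mapping.single x (Poly_Mapping.lookup p x)) *
      (\<Sum>y\<in>Poly_Mapping.keys q. Poly_Mapping.single y (Poly_Mapping.lookup q y))"
    by (simp only: sum_singles)
  also have "\<dots> = (\<Sum>x\<in>Poly_Mapping.keys p. \<Sum>y\<in>Poly_Mapping.keys q.
      Poly_Mapping.single (x + y) (Poly_Mapping.lookup p x * Poly_Mapping.lookup q y))"
    by (simp add: sum_product mult_single)
  finally have "Poly_Mapping.lookup (p * q) (u + v) = (\<Sum>x\<in>Poly_Mapping.keys p. \<Sum>y\<in>Poly_Mapping.keys q.
      if x + y = u + v then Poly_Mapping.lookup p x * Poly_Mapping.lookup q y else 0)"
    by (simp add: lookup_sum lookup_single when_def)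
  also have "\<dots> = (\<Sum>x\<in>Poly_Mapping.keys p. \<Sum>y\<in>Poly_Mapping.keys q.
      if x = u then if y = v then Poly_Mapping.lookup p x * Poly_Mapping.lookup q y else 0 else 0)"
  proof (intro sum.cong refl)
    fix x y assume "x \<in> Poly_Mapping.keys p" "y \<in> Poly_Mapping.keys q"
    then have "length (letters x) \<le> length (letters u)" "length (letters y) \<le> length (letters v)"
      using word_degree_ge u v by metis+
    moreover have "length (letters x) + length (letters y) = length (letters u) + length (letters v)"
      if "x + y = u + v" using that length_letters_plus by metis
    ultimately have "x + y = u + v \<longleftrightarrow> x = u \<and> y = v"
      using plus_free_monoid_cancel[of x y u v] by fastforce
    then show "(if x + y = u + v then Poly_Mapping.lookup p x * Poly_Mapping.lookup q y else 0) =
      (if x = u then if y = v then Poly_Mapping.lookup p x * Poly_Mapping.lookup q y else 0 else 0)"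
      by simp
  qed
  also have "\<dots> = (\<Sum>x\<in>Poly_Mapping.keys p. if x = u then \<Sum>y\<in>Poly_Mapping.keys q.
      if y = v then Poly_Mapping.lookup p x * Poly_Mapping.lookup q y else 0 else 0)"
    by (intro sum.cong refl) simp
  also have "\<dots> = Poly_Mapping.lookup p u * Poly_Mapping.lookup q v"
    using u v by simp
  finally show ?thesis .
qed

text \<open>The coefficient in \<open>lookup_mult_leading\<close> is a product of nonzero field
  elements, so leading words survive in the product.\<close>

lemma word_degree_mult:
  fixes p q :: "'x free_monoid \<Rightarrow>\<^sub>0 'k::field"
  assumes "p \<noteq> 0" "q \<noteq> 0"
  shows "p * q \<noteq> 0" "word_degree (p * q) = word_degree p + word_degree q"
proof -
  obtain u v where u: "u \<in> Poly_Mapping.keys p" "length (letters u) = word_degree p"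
    and v: "v \<in> Poly_Mapping.keys q" "length (letters v) = word_degree q"
    using assms word_degree_attained by blast
  have uv: "u + v \<in> Poly_Mapping.keys (p * q)"
    using u v lookup_mult_leading[of u p v q] by (simp add: in_keys_iff)
  then show "p * q \<noteq> 0" by auto
  have "word_degree (p * q) \<le> word_degree p + word_degree q"
    unfolding word_degree_le_iff
  proof
    fix w assume "w \<in> Poly_Mapping.keys (p * q)"
    then obtain x y where "w = x + y" "x \<in> Poly_Mapping.keys p" "y \<in> Poly_Mapping.keys q"
      using Poly_Mapping.keys_mult[of p q] by blast
    then show "length (letters w) \<le> word_degree p + word_degree q"
      using word_degree_ge[of x p] word_degree_ge[of y q] by (simp add: length_letters_plus)
  qed
  moreover have "word_degree p + word_degree q \<le> word_degree (p * q)"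
    using word_degree_ge[OF uv] u v by (simp add: length_letters_plus)
  ultimately show "word_degree (p * q) = word_degree p + word_degree q" by simp
qed

lemma word_degree_eq_0_iff: "word_degree p = 0 \<longleftrightarrow> p \<in> range (Poly_Mapping.single 0)"
proof
  assume "word_degree p = 0"
  then have "w = 0" if "w \<in> Poly_Mapping.keys p" for w
    using word_degree_ge[OF that] by (cases w) (simp add: zero_free_monoid_def)
  then have "p = Poly_Mapping.single 0 (Poly_Mapping.lookup p 0)"
    by (intro poly_mapping_eqI) (auto simp: lookup_single when_def in_keys_iff)
  then show "p \<in> range (Poly_Mapping.single 0)" by blast
next
  assume "p \<in> range (Poly_Mapping.single 0)"
  then show "word_degree p = 0"
    by (auto simp: word_degree_def zero_free_monoid_def)
qed

lemma scalar_mult_eq: "scalar_mult c p = Poly_Mapping.single 0 c * p"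
  by (simp add: scalar_mult_def mult_map_scale_conv_mult)

text \<open>Each monomial commutes with the scalar, since the empty word is neutral on both sides
  and the field is commutative.\<close>

lemma scalar_central:
  "Poly_Mapping.single 0 c * p = p * Poly_Mapping.single (0::'x free_monoid) (c::'k::field)"
proof -
  have "Poly_Mapping.single 0 c * (\<Sum>w\<in>Poly_Mapping.keys p. Poly_Mapping.single w (Poly_Mapping.lookup p w)) =
    (\<Sum>w\<in>Poly_Mapping.keys p. Poly_Mapping.single w (Poly_Mapping.lookup p w)) * Poly_Mapping.single 0 c"
    by (simp add: sum_distrib_left sum_distrib_right mult_single mult.commute)
  then show ?thesis by (simp only: sum_singles)
qed

lemma single_eq_0_iff: "Poly_Mapping.single w c = 0 \<longleftrightarrow> c = 0"
  by (metis lookup_single_eq lookup_zero single_zero)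

lemma degree_domain_free_algebra:
  assumes "infinite (UNIV :: 'k::field set)"
  shows "degree_domain (free_algebra X) (range (Poly_Mapping.single 0)) 
    (word_degree :: ('x free_monoid \<Rightarrow>\<^sub>0 'k) \<Rightarrow> nat)"
proof
  fix p q :: "'x free_monoid \<Rightarrow>\<^sub>0 'k"
  assume pq: "p \<in> free_algebra X" "q \<in> free_algebra X"
  show "p + q \<in> free_algebra X"
    using pq Poly_Mapping.keys_add[of p q] unfolding free_algebra_def by blast
  show "p * q \<in> free_algebra X"
    unfolding free_algebra_def
  proof (intro CollectI ballI)
    fix w assume "w \<in> Poly_Mapping.keys (p * q)"
    then obtain x y where "w = x + y" "x \<in> Poly_Mapping.keys p" "y \<in> Poly_Mapping.keys q"
      using Poly_Mapping.keys_mult[of p q] by blast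
    then show "set (letters w) \<subseteq> X"
      using pq by (auto simp: free_algebra_def plus_free_monoid_def)
  qed
next
  fix p q :: "'x free_monoid \<Rightarrow>\<^sub>0 'k"
  show "word_degree (p + q) \<le> max (word_degree p) (word_degree q)"
    unfolding word_degree_le_iff
    using Poly_Mapping.keys_add[of p q] word_degree_ge[of _ p] word_degree_ge[of _ q]
    by (fastforce simp: le_max_iff_disj)
next
  have "inj (Poly_Mapping.single 0 :: 'k \<Rightarrow> 'x free_monoid \<Rightarrow>\<^sub>0 'k)"
    by (intro injI) (metis lookup_single_eq)
  then show "infinite (range (Poly_Mapping.single 0 :: 'k \<Rightarrow> 'x free_monoid \<Rightarrow>\<^sub>0 'k))"
    using assms finite_imageD by blast
next
  fix c :: "'x free_monoid \<Rightarrow>\<^sub>0 'k"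
  assume "c \<in> range (Poly_Mapping.single 0)" "c \<noteq> 0"
  then obtain k where k: "c = Poly_Mapping.single 0 k" "k \<noteq> 0"
    by (metis imageE single_zero)
  then have "c * Poly_Mapping.single 0 (inverse k) = 1"
    by (simp add: mult_single)
  then show "\<exists>d\<in>range (Poly_Mapping.single 0). c * d = 1" by blast
next
  show "(1 :: 'x free_monoid \<Rightarrow>\<^sub>0 'k) \<in> range (Poly_Mapping.single 0)"
    by (intro range_eqI[of _ _ 1]) simp
next
  show "(0 :: 'x free_monoid \<Rightarrow>\<^sub>0 'k) \<in> range (Poly_Mapping.single 0)"
    by (intro range_eqI[of _ _ 0]) simp
next
  show "range (Poly_Mapping.single 0) \<subseteq> (free_algebra X :: ('x free_monoid \<Rightarrow>\<^sub>0 'k) set)"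
    by (auto simp: free_algebra_def zero_free_monoid_def split: if_splits)
next
  fix c p :: "'x free_monoid \<Rightarrow>\<^sub>0 'k"
  assume "c \<in> range (Poly_Mapping.single 0)"
  then show "c * p = p * c" using scalar_central by blast
qed (auto simp: free_algebra_def mult_single word_degree_eq_0_iff word_degree_mult
    simp flip: single_add single_uminus)

section \<open>Free bases as independent generating tuples\<close>

context
  fixes X :: "'x set" and a :: "nat \<Rightarrow> 'x free_monoid \<Rightarrow>\<^sub>0 'k::field" and n :: nat
  assumes infinite_field: "infinite (UNIV :: 'k set)" and a: "\<forall>i<n. a i \<in> free_algebra X"
begin

interpretation degree_domain "free_algebra X" "range (Poly_Mapping.single 0)"
  "word_degree :: ('x free_monoid \<Rightarrow>\<^sub>0 'k) \<Rightarrow> nat"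
  using infinite_field by (rule degree_domain_free_algebra)

abbreviation (input) monomial :: "nat list \<Rightarrow> 'x free_monoid \<Rightarrow>\<^sub>0 'k" where
  "monomial w \<equiv> prod_list (map a w)"

lemma span_monomials: "free_alg.span (monomial ` lists {..<n}) = (\<Union>N. spanned a n N)"
proof
  show "free_alg.span (monomial ` lists {..<n}) \<subseteq> (\<Union>N. spanned a n N)"
  proof (rule free_alg.span_minimal)
    show "monomial ` lists {..<n} \<subseteq> (\<Union>N. spanned a n N)"
    proof (rule image_subsetI)
      fix w assume w: "w \<in> lists {..<n}"
      let ?u = "\<lambda>x. if x = w then 1 else 0 :: 'x free_monoid \<Rightarrow>\<^sub>0 'k"
      have "range ?u \<subseteq> range (Poly_Mapping.single 0)" using one_K zero_K by auto
      moreover have "w \<in> words n (length w)" using w by (auto simp: words_def)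
      then have "monomial w = word_comb a n (length w) ?u"
        by (simp add: word_comb_def if_distrib[of "\<lambda>x. x * _"] cong: if_cong)
      ultimately show "monomial w \<in> (\<Union>N. spanned a n N)" unfolding spanned_def by blast
    qed
    show "free_alg.subspace (\<Union>N. spanned a n N)"
    proof (rule free_alg.subspaceI)
      show "0 \<in> (\<Union>N. spanned a n N)"
        using zero_K by (intro UN_I[of 0]) (simp_all only: spanned_0 UNIV_I)
    next
      fix x y assume "x \<in> (\<Union>N. spanned a n N)" "y \<in> (\<Union>N. spanned a n N)"
      then obtain N M where "x \<in> spanned a n N" "y \<in> spanned a n M" by blast
      from spanned_add[OF this] show "x + y \<in> (\<Union>N. spanned a n N)" by blast
    next
      fix c x assume "x \<in> (\<Union>N. spanned a n N)"
      then obtain N where "x \<in> spanned a n N" by blast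
      from spanned_scale[OF rangeI this] show "scalar_mult c x \<in> (\<Union>N. spanned a n N)"
        unfolding scalar_mult_eq by blast
    qed
  qed
  show "(\<Union>N. spanned a n N) \<subseteq> free_alg.span (monomial ` lists {..<n})"
  proof
    fix x assume "x \<in> (\<Union>N. spanned a n N)"
    then obtain N u where u: "range u \<subseteq> range (Poly_Mapping.single 0)" "x = word_comb a n N u"
      by (auto simp: spanned_def)
    have "u w * monomial w \<in> free_alg.span (monomial ` lists {..<n})" if "w \<in> words n N" for w
    proof -
      obtain k where "u w = Poly_Mapping.single 0 k" using range_subsetD[OF u(1), of w] by blast
      moreover have "w \<in> lists {..<n}" using that by (auto simp: words_def)
      ultimately show ?thesis
        by (simp only: flip: scalar_mult_eq) (intro free_alg.span_scale free_alg.span_base imageI)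
    qed
    then show "x \<in> free_alg.span (monomial ` lists {..<n})"
      unfolding u(2) word_comb_def by (rule free_alg.span_sum)
  qed
qed

lemma word_independent_iff:
  "word_independent a n \<longleftrightarrow>
    inj_on monomial (lists {..<n}) \<and> free_alg.independent (monomial ` lists {..<n})"
proof
  assume ind: "word_independent a n"
  have inj: "inj_on monomial (lists {..<n})"
  proof (rule inj_onI, rule ccontr)
    fix w w' assume w: "w \<in> lists {..<n}" "w' \<in> lists {..<n}" "monomial w = monomial w'" "w \<noteq> w'"
    define N where "N = max (length w) (length w')"
    have wN: "w \<in> words n N" "w' \<in> words n N" using w by (auto simp: words_def N_def)
    \<comment> \<open>These coefficients encode the relation
      \<open>monomial w - monomial w' = 0\<close>.\<close>
    define u :: "nat list \<Rightarrow> 'x free_monoid \<Rightarrow>\<^sub>0 'k" where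
      "u = (\<lambda>x. if x = w then 1 else if x = w' then - 1 else 0)"
    have "range u \<subseteq> range (Poly_Mapping.single 0)"
      using one_K zero_K K_uminus[OF one_K] by (auto simp: u_def)
    moreover have "word_comb a n N u = (\<Sum>x\<in>{w, w'}. u x * monomial x)"
      unfolding word_comb_def using wN by (intro sum.mono_neutral_right) (auto simp: u_def)
    then have "word_comb a n N u = 0" using w by (simp add: u_def)
    ultimately have "u w = 0"
      using ind[unfolded word_independent_def, rule_format, of u N w] wN by simp
    then show False by (simp add: u_def)
  qed
  moreover have "free_alg.independent (monomial ` lists {..<n})"
    unfolding free_alg.independent_explicit_module
  proof (intro allI impI)
    fix t k v
    assume t: "finite t" "t \<subseteq> monomial ` lists {..<n}" "(\<Sum>v\<in>t. scalar_mult (k v) v) = 0" "v \<in> t"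
    obtain T where T: "T \<subseteq> lists {..<n}" "finite T" "t = monomial ` T"
      using finite_subset_image[OF t(1,2)] by blast
    define N where "N = Max (length ` T)"
    have TN: "T \<subseteq> words n N" using T by (auto simp: words_def N_def)
    \<comment> \<open>The coefficients on products are pulled back to the words in \<open>T\<close>,
      which injectivity puts in bijection with \<open>t\<close>.\<close>
    define u where "u = (\<lambda>w. if w \<in> T then Poly_Mapping.single (0::'x free_monoid) (k (monomial w)) else 0)"
    have "range u \<subseteq> range (Poly_Mapping.single 0)" using zero_K by (auto simp: u_def)
    moreover have "word_comb a n N u = (\<Sum>w\<in>T. scalar_mult (k (monomial w)) (monomial w))"
      unfolding word_comb_def scalar_mult_eq using TN by (intro sum.mono_neutral_cong_right) (auto simp: u_def)
    moreover have "\<dots> = (\<Sum>v\<in>t. scalar_mult (k v) v)"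
      unfolding T(3) using inj_on_subset[OF inj T(1)] by (simp add: sum.reindex)
    ultimately have zero: "\<forall>w\<in>words n N. u w = 0"
      using ind[unfolded word_independent_def, rule_format, of u N] t(3) by simp
    obtain w where "w \<in> T" "v = monomial w" using t(4) T(3) by blast
    then show "k v = 0" using zero TN by (auto simp: u_def single_eq_0_iff dest!: bspec)
  qed
  ultimately show "inj_on monomial (lists {..<n}) \<and> free_alg.independent (monomial ` lists {..<n})" ..
next
  assume "inj_on monomial (lists {..<n}) \<and> free_alg.independent (monomial ` lists {..<n})"
  then have inj: "inj_on monomial (lists {..<n})"
    and ind: "free_alg.independent (monomial ` lists {..<n})" by blast+
  show "word_independent a n"
    unfolding word_independent_def
  proof (intro allI impI ballI)
    fix N w and u :: "nat list \<Rightarrow> 'x free_monoid \<Rightarrow>\<^sub>0 'k"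
    assume u: "range u \<subseteq> range (Poly_Mapping.single 0)" "word_comb a n N u = 0" and w: "w \<in> words n N"
    obtain k where k: "\<And>w. u w = Poly_Mapping.single 0 (k w)"
      using range_subsetD[OF u(1)] unfolding image_iff by metis
    have sub: "words n N \<subseteq> lists {..<n}" by (auto simp: words_def)
    have injN: "inj_on monomial (words n N)" using inj_on_subset[OF inj sub] .
    \<comment> \<open>The coefficients on words are carried over to products through the inverse of
      \<open>monomial\<close> on \<open>words n N\<close>.\<close>
    define k' where "k' = (\<lambda>v. k (inv_into (words n N) monomial v))"
    have k': "k' (monomial w) = k w" if "w \<in> words n N" for w
      using inv_into_f_f[OF injN that] by (simp add: k'_def)
    have "(\<Sum>v\<in>monomial ` words n N. scalar_mult (k' v) v) = word_comb a n N u"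
      using injN by (simp add: sum.reindex k' word_comb_def k scalar_mult_eq)
    then have "k' (monomial w) = 0"
      using u(2) w by (intro free_alg.independentD[OF ind _ image_mono[OF sub]]) simp_all
    then show "u w = 0" using k k' w by simp
  qed
qed

text \<open>The cardinality condition makes \<open>a\<close> injective, so words over the set of
  values correspond to words of indices. For generating tuples, independence of words and right
  independence agree.\<close>

lemma free_basis_iff:
  "is_free_basis X (a ` {..<n}) \<and> card (a ` {..<n}) = n \<longleftrightarrow> right_independent a n \<and> generating a n"
proof -
  have img: "prod_list ` lists (a ` {..<n}) = monomial ` lists {..<n}"
    by (simp add: lists_image image_image)
  have sub: "a ` {..<n} \<subseteq> free_algebra X" using a by auto
  have card: "card (a ` {..<n}) = n \<longleftrightarrow> inj_on a {..<n}"
    by (simp add: inj_on_iff_eq_card)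
  have inj: "inj_on prod_list (lists (a ` {..<n})) \<and> inj_on a {..<n} \<longleftrightarrow> inj_on monomial (lists {..<n})"
  proof
    assume *: "inj_on prod_list (lists (a ` {..<n})) \<and> inj_on a {..<n}"
    then have "inj_on (map a) (lists {..<n})" by (simp add: inj_on_map_lists)
    with * show "inj_on monomial (lists {..<n})"
      using comp_inj_on[of "map a" "lists {..<n}" prod_list] by (simp add: lists_image comp_def)
  next
    assume *: "inj_on monomial (lists {..<n})"
    then have "inj_on prod_list (map a ` lists {..<n})" using inj_on_imageI[of prod_list "map a"] by (simp add: comp_def)
    \<comment> \<open>Words of one letter show that \<open>a\<close> itself is injective.\<close>
    moreover have "i = j" if "i < n" "j < n" "a i = a j" for i j
      using inj_onD[OF *, of "[i]" "[j]"] that by simp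
    then have "inj_on a {..<n}" by (auto intro!: inj_onI)
    ultimately show "inj_on prod_list (lists (a ` {..<n})) \<and> inj_on a {..<n}" by (simp add: lists_image)
  qed
  have span: "free_alg.span (prod_list ` lists (a ` {..<n})) = free_algebra X \<longleftrightarrow> generating a n"
  proof -
    have "(\<Union>N. spanned a n N) \<subseteq> free_algebra X" by (intro UN_least spanned_subset[OF a])
    then show ?thesis unfolding img span_monomials generating_def by blast
  qed
  have "is_free_basis X (a ` {..<n}) \<and> card (a ` {..<n}) = n \<longleftrightarrow> word_independent a n \<and> generating a n"
    unfolding is_free_basis_def span card unfolding img word_independent_iff
    using inj sub by argo
  then show ?thesis
    using right_independent_imp_word_independent[OF a]
      word_independent_imp_right_independent[of a n] by blast
qed

end

theorem theorem6p14:
  fixes X :: "'x set" and n :: nat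
  assumes "infinite (UNIV :: 'k::field set)"
    and "finite X"
    and "n = card X"
  shows "\<exists>Gen. free_vars Gen \<subseteq> {..<n} \<and>
    (\<forall>a :: nat \<Rightarrow> ('x free_monoid \<Rightarrow>\<^sub>0 'k).
      (\<forall>i<n. a i \<in> free_algebra X) \<longrightarrow>
      (satisfies (free_algebra X) a Gen \<longleftrightarrow>
        is_free_basis X (a ` {..<n}) \<and> card (a ` {..<n}) = n))"
proof -
  interpret degree_domain "free_algebra X" "range (Poly_Mapping.single 0)"
    "word_degree :: ('x free_monoid \<Rightarrow>\<^sub>0 'k) \<Rightarrow> nat"
    using assms(1) by (rule degree_domain_free_algebra)
  obtain Gen where Gen: "free_vars Gen \<subseteq> {..<n}"
    "\<And>a. \<forall>i<n. a i \<in> free_algebra X \<Longrightarrow>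
      satisfies (free_algebra X) a Gen \<longleftrightarrow> right_independent a n \<and> generating a n"
    using generating_definable by metis
  have "satisfies (free_algebra X) a Gen \<longleftrightarrow> is_free_basis X (a ` {..<n}) \<and> card (a ` {..<n}) = n"
    if "\<forall>i<n. a i \<in> free_algebra X" for a :: "nat \<Rightarrow> 'x free_monoid \<Rightarrow>\<^sub>0 'k"
    unfolding Gen(2)[OF that] free_basis_iff[OF assms(1) that] ..
  with Gen(1) show ?thesis by blast
qed

end
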